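(* Let $\Omega=\{(x,y)\in\mathbb{R}^2 : |x|<y+1,\ x^2>4y\}$ and let $1\le p<\infty$. Then the Markov exponent of $\Omega$ in the $L^p$ norm (with respect to Lebesgue measure) is $4$. That is, the minimal $r>0$ for which there exists a constant $M>0$ such that, for every integer $n\ge 1$ and every polynomial $P\in\mathcal{P}_n(\mathbb{R}^2)$, $$\max\left\{\left\|\frac{\partial P}{\partial x}\right\|_{L^p(\Omega)},\left\|\frac{\partial P}{\partial y}\right\|_{L^p(\Omega)}\right\}\le M\,n^{r}\,\|P\|_{L^p(\Omega)},$$ is $r=4$: such an $M$ exists for $r=4$, and no such $M$ exists for any $r<4$.
   Context: $\mathcal{P}_n(\mathbb{R}^2)$ denotes the set of real polynomials in two variables of total degree at most $n$. $\|f\|_{L^p(\Omega)}=\left(\int_\Omega |f(x,y)|^p\,dx\,dy\right)^{1/p}$. The Markov exponent of a set in a given norm is the minimal exponent $r$ for which a Markov inequality (bound on first-order partial derivatives of polynomials by a constant times degree to the power $r$ times the norm of the polynomial) holds.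
   Formalization: The set Ω as written is unbounded (it contains (10,20)), so nonzero polynomials have infinite L^p norm on it and the claim fails; the formal statement adds the condition |x|<2, selecting the bounded region between the two lines and the parabola. *)

theory Defs
  imports "HOL-Analysis.Analysis"
begin

text \<open>Elements of \<open>poly2_deg_le n\<close> are polynomial functions; over the reals these correspond
  one-to-one to formal polynomials of total degree at most \<open>n\<close>.\<close>

definition poly2_deg_le :: "nat \<Rightarrow> (real \<times> real \<Rightarrow> real) set" where
  "poly2_deg_le n =
     {P. \<exists>c :: nat \<Rightarrow> nat \<Rightarrow> real. \<forall>x y.
           P (x, y) = (\<Sum>(i, j) \<in> {(i, j). i + j \<le> n}. c i j * x ^ i * y ^ j)}"

definition partial_x :: "(real \<times> real \<Rightarrow> real) \<Rightarrow> real \<times> real \<Rightarrow> real" where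
  "partial_x f = (\<lambda>(x, y). deriv (\<lambda>t. f (t, y)) x)"

definition partial_y :: "(real \<times> real \<Rightarrow> real) \<Rightarrow> real \<times> real \<Rightarrow> real" where
  "partial_y f = (\<lambda>(x, y). deriv (\<lambda>t. f (x, t)) y)"

text \<open>The Bochner integral of a non-integrable function is 0, so \<open>Lp_norm\<close> is meaningful only
  when \<open>\<bar>f\<bar> powr p\<close> is integrable on \<open>S\<close>, as it is for polynomials on bounded Borel sets.\<close>

definition Lp_norm :: "real \<Rightarrow> (real \<times> real) set \<Rightarrow> (real \<times> real \<Rightarrow> real) \<Rightarrow> real" where
  "Lp_norm p S f = (LINT z:S|lborel. \<bar>f z\<bar> powr p) powr (1 / p)"

definition markov_inequality :: "real \<Rightarrow> (real \<times> real) set \<Rightarrow> real \<Rightarrow> bool" where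
  "markov_inequality p S r \<longleftrightarrow>
     (\<exists>M>0. \<forall>n\<ge>1. \<forall>P \<in> poly2_deg_le n.
        max (Lp_norm p S (partial_x P)) (Lp_norm p S (partial_y P))
          \<le> M * real n powr r * Lp_norm p S P)"

definition is_markov_exponent :: "real \<Rightarrow> (real \<times> real) set \<Rightarrow> real \<Rightarrow> bool" where
  "is_markov_exponent p S r \<longleftrightarrow>
     r > 0 \<and> markov_inequality p S r \<and> (\<forall>s<r. \<not> markov_inequality p S s)"

text \<open>The region enclosed by the lines \<open>y = \<plusminus>x - 1\<close> and the parabola \<open>x\<^sup>2 = 4y\<close>, which are tangent
  at the cusps \<open>(\<plusminus>2, 1)\<close>. It is usually written with the last two conditions only. Read literally,
  these also admit two unbounded pieces, \<open>x > 2\<close> and \<open>x < -2\<close>, on which no nonzero polynomial is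
  in \<open>L\<^sup>p\<close>; the condition \<open>\<bar>x\<bar> < 2\<close> selects the bounded piece.\<close>

definition Omega :: "(real \<times> real) set" where
  "Omega = {(x, y). \<bar>x\<bar> < 2 \<and> \<bar>x\<bar> < y + 1 \<and> x\<^sup>2 > 4 * y}"

lemma bounded_Omega: "bounded Omega"
proof (rule bounded_subset)
  show "Omega \<subseteq> cbox (-2, -1) (2, 1)"
  proof
    fix z assume "z \<in> Omega"
    then obtain x y where z: "z = (x, y)" and h: "\<bar>x\<bar> < 2" "\<bar>x\<bar> < y + 1" "x\<^sup>2 > 4 * y"
      by (auto simp: Omega_def)
    have "x\<^sup>2 \<le> 2\<^sup>2"
      using h(1) abs_le_square_iff[of x 2] by simp
    then show "z \<in> cbox (-2, -1) (2, 1)"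
      using h z by (auto simp: cbox_Pair_eq)
  qed
qed simp

lemma literal_region_avoids_vertical_lines:
  fixes x y :: real
  assumes "\<bar>x\<bar> < y + 1" "x\<^sup>2 > 4 * y"
  shows "\<bar>x\<bar> \<noteq> 2"
proof
  assume x: "\<bar>x\<bar> = 2"
  have "x\<^sup>2 = \<bar>x\<bar>\<^sup>2" by simp
  also have "\<dots> = 4" using x by simp
  finally show False using assms x by simp
qed

text \<open>Equivalently, \<open>Omega\<close> consists of the values of the elementary symmetric polynomials at
  pairs of distinct points of \<open>(-1, 1)\<close>.\<close>

lemma Omega_eq_image:
  "Omega = (\<lambda>(s, t). (s + t, s * t)) ` {(s, t). -1 < s \<and> s < t \<and> t < 1}"
proof (intro set_eqI iffI)
  fix z assume "z \<in> Omega"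
  then obtain x y where z: "z = (x, y)" and h: "\<bar>x\<bar> < 2" "\<bar>x\<bar> < y + 1" "x\<^sup>2 > 4 * y"
    by (auto simp: Omega_def)
  define d where "d = sqrt (x\<^sup>2 - 4 * y)"
  have d: "d > 0" "d\<^sup>2 = x\<^sup>2 - 4 * y"
    using h(3) by (auto simp: d_def)
  have "x\<^sup>2 - 4 * y < (2 - \<bar>x\<bar>)\<^sup>2"
    using h(2) by (simp add: power2_diff)
  then have d_less: "d < 2 - \<bar>x\<bar>"
    using power2_less_imp_less[of d "2 - \<bar>x\<bar>"] d(2) h(1) by simp
  define s t where "s = (x - d) / 2" and "t = (x + d) / 2"
  have "-1 < s" "s < t" "t < 1"
    using d_less d(1) abs_ge_self[of x] abs_ge_minus_self[of x]
    by (simp_all add: s_def t_def field_simps)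
  moreover have "x = s + t" by (simp add: s_def t_def field_simps)
  moreover have "y = s * t"
  proof -
    have "s * t = (x\<^sup>2 - d\<^sup>2) / 4"
      unfolding s_def t_def by (simp add: power2_eq_square algebra_simps)
    then show ?thesis using d(2) by simp
  qed
  ultimately show "z \<in> (\<lambda>(s, t). (s + t, s * t)) ` {(s, t). -1 < s \<and> s < t \<and> t < 1}"
    unfolding z image_iff by (intro bexI[of _ "(s, t)"]) simp_all
next
  fix z assume "z \<in> (\<lambda>(s, t). (s + t, s * t)) ` {(s, t). -1 < s \<and> s < t \<and> t < (1::real)}"
  then obtain s t where z: "z = (s + t, s * t)" and h: "-1 < s" "s < t" "t < (1::real)"
    by auto
  have pos: "(1 - s) * (1 - t) > 0" "(1 + s) * (1 + t) > 0" "(t - s) * (t - s) > 0"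
    using h by simp_all
  have "\<bar>s + t\<bar> < s * t + 1"
    using pos(1,2) by (simp add: algebra_simps abs_less_iff)
  moreover have "(s + t)\<^sup>2 > 4 * (s * t)"
    using pos(3) by (simp add: power2_eq_square algebra_simps)
  moreover have "\<bar>s + t\<bar> < 2"
    using h by linarith
  ultimately show "z \<in> Omega"
    by (simp add: z Omega_def)
qed

end

theory Submission
  imports Defs "HOL-Computational_Algebra.Polynomial"
begin

text \<open>Upper bound: a value \<open>q(0)\<close> of a polynomial of degree at most \<open>n\<close> is a linear combination,
  with coefficients bounded in \<open>\<ell>\<^sup>1\<close> independently of \<open>n\<close>, of its values at points of
  \<open>[1/(2n\<^sup>2), 1]\<close>; hence \<open>q'(0)\<close> is a combination of values on \<open>[0, 1]\<close> with \<open>\<ell>\<^sup>1\<close>-norm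
  \<open>O(n\<^sup>2)\<close>. On segments in a fixed direction \<open>v\<close> this writes \<open>\<partial>\<^sub>v P\<close> as a combination of translates
  of \<open>P\<close>, and as translations preserve the \<open>L\<^sup>p\<close> norm, a derivative in a direction in which the
  domain allows a step of fixed length costs only \<open>O(n\<^sup>2)\<close>. At distance at least \<open>1/n\<^sup>2\<close> from a
  cusp there are two such directions enclosing an angle of order \<open>1/n\<^sup>2\<close>, and every derivative is
  a combination of these two with coefficients \<open>O(n\<^sup>2)\<close>. The remaining neighbourhood of the cusp is
  reached by extrapolation along the cusp tangent.

  Lower bound: \<open>P = (y - x + 1) G(x)\<close>, where \<open>G\<close> peaks at \<open>x = 2\<close> with width \<open>1/n\<^sup>2\<close>.
  There \<open>y - x + 1 \<le> (2 - x)\<^sup>2 / 4\<close> is of order \<open>1/n\<^sup>4\<close>, whereas \<open>\<partial>P/\<partial>y = G\<close>.\<close>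

subsection \<open>Extrapolation and differentiation functionals\<close>

text \<open>The interpolant \<open>r\<close> has degree below \<open>card I\<close> and agrees with
  \<open>q\<close> at the nodes, which are \<open>card I\<close> distinct points, so the two
  coincide. Nodes are indexed by \<open>I\<close> so that the weights can be estimated through the
  index.\<close>

lemma Lagrange_interpolation:
  fixes x :: "'i \<Rightarrow> real" and q :: "real poly"
  assumes "finite I" "inj_on x I" "degree q < card I"
  shows "poly q z = (\<Sum>k\<in>I. (\<Prod>j\<in>I - {k}. (z - x j) / (x k - x j)) * poly q (x k))"
proof -
  define l where "l k = (\<Prod>j\<in>I - {k}. Polynomial.smult (1 / (x k - x j)) [:- x j, 1:])" for k
  define r where "r = (\<Sum>k\<in>I. Polynomial.smult (poly q (x k)) (l k))"
  have pl: "poly (l k) w = (\<Prod>j\<in>I - {k}. (w - x j) / (x k - x j))" for k w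
    unfolding l_def poly_prod by (intro prod.cong) (auto simp: diff_divide_distrib)
  have pr: "poly r w = (\<Sum>k\<in>I. (\<Prod>j\<in>I - {k}. (w - x j) / (x k - x j)) * poly q (x k))" for w
    unfolding r_def poly_sum by (intro sum.cong) (auto simp: pl)
  have "card I > 0" using assms(3) by linarith
  have "degree (l k) \<le> card I - 1" if "k \<in> I" for k
  proof -
    have "degree (l k) \<le> (\<Sum>j\<in>I - {k}. degree (Polynomial.smult (1 / (x k - x j)) [:- x j, 1:]))"
      unfolding l_def by (rule order_trans[OF degree_prod_sum_le]) (use assms in \<open>auto simp: o_def\<close>)
    also have "\<dots> \<le> (\<Sum>j\<in>I - {k}. 1)"
      by (intro sum_mono) (auto intro: order_trans[OF degree_smult_le])
    finally show ?thesis using that assms(1) by simp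
  qed
  then have "degree r \<le> card I - 1"
    unfolding r_def by (intro degree_sum_le) (use assms in \<open>auto intro: order_trans[OF degree_smult_le]\<close>)
  then have "degree r < card I" using \<open>card I > 0\<close> by linarith
  moreover have "card (x ` I) = card I" using assms(2) by (rule card_image)
  moreover have "poly q w = poly r w" if "w \<in> x ` I" for w
  proof -
    obtain m where m: "m \<in> I" "w = x m" using \<open>w \<in> x ` I\<close> by auto
    have "(\<Prod>j\<in>I - {k}. (w - x j) / (x k - x j)) = (if k = m then 1 else 0)" if "k \<in> I" for k
    proof (cases "k = m")
      case True
      have "(w - x j) / (x k - x j) = 1" if "j \<in> I - {k}" for j
        using that True m assms(2) by (auto simp: inj_on_def)
      then have "(\<Prod>j\<in>I - {k}. (w - x j) / (x k - x j)) = 1" by (rule prod.neutral[OF ballI])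
      then show ?thesis using True by simp
    next
      case False
      then have "\<exists>j\<in>I - {k}. (w - x j) / (x k - x j) = 0"
        using m by (intro bexI[of _ m]) auto
      then show ?thesis using False assms(1) by (auto intro!: prod_zero)
    qed
    then have "poly r w = (\<Sum>k\<in>I. if k = m then poly q (x k) else 0)"
      unfolding pr by (intro sum.cong) auto
    then show ?thesis using m assms(1) by simp
  qed
  ultimately have "q = r"
    using assms(3) by (intro poly_eqI_degree[of "x ` I" q r]) simp_all
  then have "poly q z = poly r z" by simp
  also note pr
  finally show ?thesis .
qed

section \<open>Size of the Lagrange weights for quadratically spaced nodes\<close>

lemma of_nat_square_eq_iff: "(real j)\<^sup>2 = (real k)\<^sup>2 \<longleftrightarrow> j = k"
  using power2_eq_iff_nonneg[of "real j" "real k"] by simp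

text \<open>Factor each difference as (j - k)(j + k). In absolute value the first factors give (k -
  1)! (n - k)!, the second give (n + k)! / (k! * 2k), and the quotient leaves 2k^2. The induction
  starts at n = k, where every j lies below k.\<close>

lemma prod_square_diff:
  assumes "1 \<le> k" "k \<le> n"
  shows "2 * (real k)\<^sup>2 * (\<Prod>j\<in>{1..n} - {k}. \<bar>(real j)\<^sup>2 - (real k)\<^sup>2\<bar>) = fact (n - k) * fact (n + k)"
  using assms(2)
proof (induction n rule: dec_induct)
  case base
  have minus: "m < k \<Longrightarrow> (\<Prod>j\<in>{1..m}. real k - real j) * fact (k - 1 - m) = fact (k - 1)" for m
  proof (induction m)
    case (Suc m)
    have "(fact (k - 1 - m) :: real) = (real k - real (Suc m)) * fact (k - 1 - Suc m)"
      using Suc.prems by (subst fact_reduce) (auto simp: of_nat_diff)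
    then show ?case using Suc by (simp add: mult.assoc)
  qed simp
  have plus: "(\<Prod>j\<in>{1..m}. real k + real j) * fact k = fact (k + m)" for m
  proof (induction m)
    case (Suc m)
    have "(\<Prod>j\<in>{1..Suc m}. real k + real j) * fact k = (real k + real (Suc m)) * ((\<Prod>j\<in>{1..m}. real k + real j) * fact k)"
      by simp
    also have "\<dots> = fact (k + Suc m)" unfolding Suc by simp
    finally show ?case .
  qed simp
  have "{1..k} - {k} = {1..k - 1}" by auto
  then have "(\<Prod>j\<in>{1..k} - {k}. \<bar>(real j)\<^sup>2 - (real k)\<^sup>2\<bar>)
      = (\<Prod>j\<in>{1..k - 1}. (real k - real j) * (real k + real j))"
  proof (intro prod.cong)
    fix j assume "j \<in> {1..k - 1}"
    then have "real j \<le> real k" by auto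
    then have "(real j)\<^sup>2 \<le> (real k)\<^sup>2" by (intro power_mono) auto
    then show "\<bar>(real j)\<^sup>2 - (real k)\<^sup>2\<bar> = (real k - real j) * (real k + real j)"
      by (simp add: abs_if power2_eq_square algebra_simps)
  qed auto
  also have "\<dots> = fact (k - 1) * (fact (k + (k - 1)) / fact k)"
    using minus[of "k - 1"] plus[of "k - 1"] assms(1) by (simp add: prod.distrib eq_divide_eq mult.assoc)
  finally have *: "(\<Prod>j\<in>{1..k} - {k}. \<bar>(real j)\<^sup>2 - (real k)\<^sup>2\<bar>) = fact (k - 1) * (fact (k + (k - 1)) / fact k)" .
  have "(fact k :: real) = real k * fact (k - 1)" using assms(1) by (subst fact_reduce) auto
  moreover have "(fact (k + k) :: real) = real (k + k) * fact (k + (k - 1))"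
    using assms(1) by (subst fact_reduce) auto
  ultimately show ?case unfolding * using assms(1) by (simp add: power2_eq_square)
next
  case (step n)
  have "{1..Suc n} - {k} = insert (Suc n) ({1..n} - {k})" using step assms by auto
  moreover have "\<bar>(real (Suc n))\<^sup>2 - (real k)\<^sup>2\<bar> = (real (Suc n) - real k) * (real (Suc n) + real k)"
  proof -
    have "(real k)\<^sup>2 \<le> (real (Suc n))\<^sup>2" using step by (intro power_mono) auto
    then show ?thesis by (simp add: power2_eq_square algebra_simps)
  qed
  ultimately have "2 * (real k)\<^sup>2 * (\<Prod>j\<in>{1..Suc n} - {k}. \<bar>(real j)\<^sup>2 - (real k)\<^sup>2\<bar>)
      = (real (Suc n) - real k) * (real (Suc n) + real k) * 
        (2 * (real k)\<^sup>2 * (\<Prod>j\<in>{1..n} - {k}. \<bar>(real j)\<^sup>2 - (real k)\<^sup>2\<bar>))"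
    by (simp add: mult_ac)
  also have "\<dots> = (real (Suc n) - real k) * fact (n - k) * ((real (Suc n) + real k) * fact (n + k))"
    unfolding step.IH by simp
  also have "\<dots> = fact (Suc n - k) * fact (Suc n + k)"
    using step by (simp add: Suc_diff_le algebra_simps)
  finally show ?case .
qed

text \<open>The central binomial coefficient is the largest one in row 2n; it is compared with
  \<open>2 * n choose (n + k)\<close>.\<close>

lemma fact_square_le:
  assumes "k \<le> n"
  shows "(fact n)\<^sup>2 \<le> (fact (n - k) * fact (n + k) :: real)"
proof -
  have "real (2 * n choose (n + k)) \<le> real (2 * n choose n)"
    using binomial_maximum'[of n "n + k"] by simp
  moreover have "2 * n - (n + k) = n - k" "2 * n - n = n" by auto
  ultimately have "fact (2 * n) / (fact (n + k) * fact (n - k)) \<le> (fact (2 * n) / (fact n * fact n) :: real)"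
    using assms by (simp add: binomial_fact)
  then have "(fact n * fact n :: real) \<le> fact (n + k) * fact (n - k)"
    using divide_strict_left_mono[of "fact (n + k) * fact (n - k)" "fact n * fact n" "fact (2 * n) :: real"]
    by (intro leI) auto
  then show ?thesis
    by (simp add: power2_eq_square mult.commute)
qed

text \<open>By \<open>prod_square_diff\<close> the product equals 2 (n!)^2 / ((n - k)! (n + k)!),
  and \<open>fact_square_le\<close> bounds the quotient of factorials by 1.\<close>

lemma prod_ratio_squares_le:
  assumes "1 \<le> k" "k \<le> n"
  shows "(\<Prod>j\<in>{1..n} - {k}. (real j)\<^sup>2 / \<bar>(real j)\<^sup>2 - (real k)\<^sup>2\<bar>) \<le> 2"
proof -
  have "(fact n :: real) = (\<Prod>j\<in>{1..n}. real j)"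
    by (simp add: fact_prod)
  then have "(fact n)\<^sup>2 = (\<Prod>j\<in>{1..n}. (real j)\<^sup>2)"
    by (simp add: prod_power_distrib)
  also have "\<dots> = (real k)\<^sup>2 * (\<Prod>j\<in>{1..n} - {k}. (real j)\<^sup>2)"
    using assms by (subst prod.remove[of _ k]) auto
  finally have 1: "(fact n)\<^sup>2 = (real k)\<^sup>2 * (\<Prod>j\<in>{1..n} - {k}. (real j)\<^sup>2)" .
  have "(\<Prod>j\<in>{1..n} - {k}. \<bar>(real j)\<^sup>2 - (real k)\<^sup>2\<bar>) > 0"
    by (intro prod_pos) (auto simp: of_nat_square_eq_iff)
  moreover have "(real k)\<^sup>2 * (\<Prod>j\<in>{1..n} - {k}. (real j)\<^sup>2) 
     \<le> (real k)\<^sup>2 * (2 * (\<Prod>j\<in>{1..n} - {k}. \<bar>(real j)\<^sup>2 - (real k)\<^sup>2\<bar>))"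
    using 1 fact_square_le[OF assms(2)] prod_square_diff[OF assms] by (simp add: algebra_simps)
  then have "(\<Prod>j\<in>{1..n} - {k}. (real j)\<^sup>2) \<le> 2 * (\<Prod>j\<in>{1..n} - {k}. \<bar>(real j)\<^sup>2 - (real k)\<^sup>2\<bar>)"
    using assms(1) by simp
  ultimately show ?thesis by (simp add: prod_dividef field_simps)
qed

lemma sum_inverse_squares_le: "(\<Sum>j=1..n. 1 / (real j)\<^sup>2) \<le> 2"
proof -
  \<comment> \<open>The sharper bound 2 - 1/n carries the induction, since 1/(n + 1)^2 \<le> 1/n -
    1/(n + 1).\<close>
  have "n \<ge> 1 \<Longrightarrow> (\<Sum>j=1..n. 1 / (real j)\<^sup>2) \<le> 2 - 1 / real n"
  proof (induction n rule: dec_induct)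
    case (step n)
    have "1 / (real (Suc n))\<^sup>2 \<le> 1 / real n - 1 / real (Suc n)"
      using step by (simp add: divide_simps power2_eq_square)
    then show ?case using step by simp
  qed simp
  moreover have "2 - 1 / real n \<le> 2" by simp
  ultimately have "n \<ge> 1 \<Longrightarrow> ?thesis" by linarith
  then show ?thesis by (cases "n = 0") auto
qed

lemma prod_Suc_squares_le:
  assumes "A \<subseteq> {1..n}"
  shows "(\<Prod>j\<in>A. 1 + 1 / (real j)\<^sup>2) \<le> exp 2"
proof -
  have fin: "finite A" using assms finite_subset by blast
  have "(\<Prod>j\<in>A. 1 + 1 / (real j)\<^sup>2) \<le> (\<Prod>j\<in>A. exp (1 / (real j)\<^sup>2))"
    by (intro prod_mono) auto
  also have "\<dots> = exp (\<Sum>j\<in>A. 1 / (real j)\<^sup>2)" using fin by (simp add: exp_sum)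
  also have "(\<Sum>j\<in>A. 1 / (real j)\<^sup>2) \<le> (\<Sum>j=1..n. 1 / (real j)\<^sup>2)"
    using assms by (intro sum_mono2) auto
  also have "\<dots> \<le> 2" by (rule sum_inverse_squares_le)
  finally show ?thesis by simp
qed

text \<open>Extrapolation to \<open>0\<close> from the nodes \<open>1 + k\<^sup>2\<close>. These imitate the quadratic clustering of the
  Chebyshev nodes at the end of the interval that matters; the \<open>k\<close>-th Lagrange weight is of order
  \<open>1 / k\<^sup>2\<close>, so that the weights are summable independently of the degree.\<close>

lemma extrapolation_at_squares:
  fixes n :: nat
  obtains b :: "nat \<Rightarrow> real" where "(\<Sum>k\<le>n. \<bar>b k\<bar>) \<le> 5 * exp 2"
    "\<And>(q :: real poly) h. degree q \<le> n \<Longrightarrow> poly q 0 = (\<Sum>k\<le>n. b k * poly q (h * (1 + (real k)\<^sup>2)))"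
proof
  define x where "x k = 1 + (real k)\<^sup>2" for k :: nat
  define b where "b k = (\<Prod>j\<in>{..n} - {k}. (0 - x j) / (x k - x j))" for k
  have inj: "inj_on x {..n}"
    by (auto simp: inj_on_def x_def of_nat_square_eq_iff)
  show "poly q 0 = (\<Sum>k\<le>n. b k * poly q (h * (1 + (real k)\<^sup>2)))"
    if "degree q \<le> n" for q :: "real poly" and h
  proof -
    \<comment> \<open>Interpolating the rescaled polynomial q(h x) at the fixed nodes makes the
      weights independent of \<open>h\<close>.\<close>
    have "degree (pcompose q [:0, h:]) \<le> degree q * 1"
      unfolding degree_pcompose by (intro mult_left_mono) auto
    then have "poly (pcompose q [:0, h:]) 0 = (\<Sum>k\<le>n. b k * poly (pcompose q [:0, h:]) (x k))"
      using that unfolding b_def by (intro Lagrange_interpolation inj) auto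
    then show ?thesis by (simp add: poly_pcompose x_def mult.commute)
  qed
  have split: "{..n} - {k} = insert 0 ({1..n} - {k})" if "k \<ge> 1" for k
    using that by (auto simp: not_less_eq_eq)
  have bk: "\<bar>b k\<bar> \<le> 2 * exp 2 * (1 / (real k)\<^sup>2)" if k: "k \<in> {1..n}" for k
  proof -
    have "\<bar>b k\<bar> = (\<Prod>j\<in>{..n} - {k}. (1 + (real j)\<^sup>2) / \<bar>(real j)\<^sup>2 - (real k)\<^sup>2\<bar>)"
      unfolding b_def abs_prod x_def
    proof (intro prod.cong refl)
      fix j
      have "\<bar>0 - (1 + (real j)\<^sup>2)\<bar> = 1 + (real j)\<^sup>2"
        by (smt (verit) zero_le_power2)
      then show "\<bar>(0 - (1 + (real j)\<^sup>2)) / (1 + (real k)\<^sup>2 - (1 + (real j)\<^sup>2))\<bar> = (1 + (real j)\<^sup>2) / \<bar>(real j)\<^sup>2 - (real k)\<^sup>2\<bar>"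
        unfolding abs_divide by (simp add: abs_minus_commute)
    qed
    \<comment> \<open>The node j = 0 alone supplies the decay 1/k^2; the product over the other
      nodes is bounded independently of k and n.\<close>
    also have "\<dots> = 1 / (real k)\<^sup>2 * (\<Prod>j\<in>{1..n} - {k}. (1 + (real j)\<^sup>2) / \<bar>(real j)\<^sup>2 - (real k)\<^sup>2\<bar>)"
      using k by (subst split) auto
    also have "(\<Prod>j\<in>{1..n} - {k}. (1 + (real j)\<^sup>2) / \<bar>(real j)\<^sup>2 - (real k)\<^sup>2\<bar>)
      = (\<Prod>j\<in>{1..n} - {k}. (1 + 1 / (real j)\<^sup>2) * ((real j)\<^sup>2 / \<bar>(real j)\<^sup>2 - (real k)\<^sup>2\<bar>))"
      by (intro prod.cong) (auto simp: field_simps)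
    also have "\<dots> = (\<Prod>j\<in>{1..n} - {k}. 1 + 1 / (real j)\<^sup>2)
        * (\<Prod>j\<in>{1..n} - {k}. (real j)\<^sup>2 / \<bar>(real j)\<^sup>2 - (real k)\<^sup>2\<bar>)"
      by (rule prod.distrib)
    also have "\<dots> \<le> exp 2 * 2"
      using k by (intro mult_mono prod_Suc_squares_le[of _ n] prod_ratio_squares_le prod_nonneg) auto
    finally show ?thesis by (simp add: mult_left_mono divide_right_mono mult.commute)
  qed
  have b0: "\<bar>b 0\<bar> \<le> exp 2"
  proof -
    have "\<bar>b 0\<bar> = (\<Prod>j\<in>{1..n}. 1 + 1 / (real j)\<^sup>2)"
      unfolding b_def abs_prod x_def
    proof (intro prod.cong)
      fix j assume "j \<in> {1..n}"
      then have "(0 - (1 + (real j)\<^sup>2)) / (1 + (real 0)\<^sup>2 - (1 + (real j)\<^sup>2)) = 1 + 1 / (real j)\<^sup>2"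
        by (simp add: field_simps)
      then show "\<bar>(0 - (1 + (real j)\<^sup>2)) / (1 + (real 0)\<^sup>2 - (1 + (real j)\<^sup>2))\<bar> = 1 + 1 / (real j)\<^sup>2"
        by simp
    qed auto
    also have "\<dots> \<le> exp 2" by (rule prod_Suc_squares_le[of _ n]) simp
    finally show ?thesis .
  qed
  have "{..n} = insert 0 {1..n}" by (auto simp: not_less_eq_eq)
  then have "(\<Sum>k\<le>n. \<bar>b k\<bar>) = \<bar>b 0\<bar> + (\<Sum>k=1..n. \<bar>b k\<bar>)" by simp
  also have "\<dots> \<le> exp 2 + (\<Sum>k=1..n. 2 * exp 2 * (1 / (real k)\<^sup>2))"
    using b0 bk by (intro add_mono sum_mono) auto
  also have "\<dots> = exp 2 + 2 * exp 2 * (\<Sum>k=1..n. 1 / (real k)\<^sup>2)"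
    by (simp add: sum_distrib_left)
  also have "\<dots> \<le> exp 2 + 2 * exp 2 * 2"
    by (intro add_left_mono mult_left_mono sum_inverse_squares_le) auto
  finally show "(\<Sum>k\<le>n. \<bar>b k\<bar>) \<le> 5 * exp 2" by simp
qed

text \<open>Scaling the nodes 1 + k^2 by h = 1/(1 + n^2) sends the largest one to 1 and the smallest
  one to h, which is at least 1/(2n^2).\<close>

lemma extrapolation_functional:
  fixes n :: nat
  assumes "n \<ge> 1"
  obtains w d :: "nat \<Rightarrow> real" where "\<And>k. k \<le> n \<Longrightarrow> 1 / (2 * (real n)\<^sup>2) \<le> d k \<and> d k \<le> 1"
    "(\<Sum>k\<le>n. \<bar>w k\<bar>) \<le> 5 * exp 2"
    "\<And>q :: real poly. degree q \<le> n \<Longrightarrow> poly q 0 = (\<Sum>k\<le>n. w k * poly q (d k))"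
proof -
  obtain b where b: "(\<Sum>k\<le>n. \<bar>b k\<bar>) \<le> 5 * exp 2"
    "\<And>(q :: real poly) h. degree q \<le> n \<Longrightarrow> poly q 0 = (\<Sum>k\<le>n. b k * poly q (h * (1 + (real k)\<^sup>2)))"
    using extrapolation_at_squares[of n] by blast
  have n1: "(real n)\<^sup>2 \<ge> 1" using assms by simp
  show ?thesis
  proof (rule that[of "\<lambda>k. 1 / (1 + (real n)\<^sup>2) * (1 + (real k)\<^sup>2)" b])
    fix k assume "k \<le> n"
    then have "(real k)\<^sup>2 \<le> (real n)\<^sup>2" by (intro power_mono) auto
    moreover have "1 / (2 * (real n)\<^sup>2) \<le> 1 / (1 + (real n)\<^sup>2)"
      using n1 assms by (intro divide_left_mono mult_pos_pos add_pos_nonneg) auto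
    moreover have "1 / (1 + (real n)\<^sup>2) \<le> 1 / (1 + (real n)\<^sup>2) * (1 + (real k)\<^sup>2)"
      using mult_left_mono[of 1 "1 + (real k)\<^sup>2" "1 / (1 + (real n)\<^sup>2)"] by simp
    moreover have "1 / (1 + (real n)\<^sup>2) * (1 + (real k)\<^sup>2) \<le> 1"
      using \<open>(real k)\<^sup>2 \<le> (real n)\<^sup>2\<close> n1 by simp
    ultimately show "1 / (2 * (real n)\<^sup>2) \<le> 1 / (1 + (real n)\<^sup>2) * (1 + (real k)\<^sup>2) \<and>
       1 / (1 + (real n)\<^sup>2) * (1 + (real k)\<^sup>2) \<le> 1"
      by linarith
  qed (rule b(1), rule b(2))
qed

text \<open>Write q(t) = a + t g(t), so that the wanted coefficient is g(0). Extrapolating g and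
  substituting g(d) = (q(d) - a)/d costs a factor 1/d \<le> 2n^2; collecting the terms with a = q(0)
  at most doubles the sum of the weights.\<close>

lemma derivative_functional:
  fixes n :: nat
  assumes "n \<ge> 1"
  obtains w d :: "nat \<Rightarrow> real" where "\<And>k. k \<le> Suc n \<Longrightarrow> 0 \<le> d k \<and> d k \<le> 1"
    "(\<Sum>k\<le>Suc n. \<bar>w k\<bar>) \<le> 20 * exp 2 * (real n)\<^sup>2"
    "\<And>q :: real poly. degree q \<le> n \<Longrightarrow> coeff q 1 = (\<Sum>k\<le>Suc n. w k * poly q (d k))"
proof (rule extrapolation_functional[OF assms])
  fix b d :: "nat \<Rightarrow> real"
  assume d: "\<And>k. k \<le> n \<Longrightarrow> 1 / (2 * (real n)\<^sup>2) \<le> d k \<and> d k \<le> 1"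
    and b: "(\<Sum>k\<le>n. \<bar>b k\<bar>) \<le> 5 * exp 2"
    and q: "\<And>q :: real poly. degree q \<le> n \<Longrightarrow> poly q 0 = (\<Sum>k\<le>n. b k * poly q (d k))"
  have dpos: "d k > 0" if "k \<le> n" for k
  proof -
    have "0 < 1 / (2 * (real n)\<^sup>2)" using assms by simp
    then show ?thesis using d[OF that] by linarith
  qed
  \<comment> \<open>The extra index n + 1 carries the node 0, which accounts for the terms with a =
    q(0).\<close>
  define w where "w k = (if k \<le> n then b k / d k else - (\<Sum>k\<le>n. b k / d k))" for k
  define e where "e k = (if k \<le> n then d k else 0)" for k
  have bd: "\<bar>b k / d k\<bar> \<le> \<bar>b k\<bar> * (2 * (real n)\<^sup>2)" if "k \<le> n" for k
  proof -
    have "1 / d k \<le> 2 * (real n)\<^sup>2"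
      using d[OF that] dpos[OF that] assms by (simp add: field_simps)
    then have "\<bar>b k\<bar> * (1 / d k) \<le> \<bar>b k\<bar> * (2 * (real n)\<^sup>2)" by (intro mult_left_mono) auto
    then show ?thesis using dpos[OF that] by simp
  qed
  have S: "(\<Sum>k\<le>n. \<bar>b k / d k\<bar>) \<le> 10 * exp 2 * (real n)\<^sup>2"
  proof -
    have "(\<Sum>k\<le>n. \<bar>b k / d k\<bar>) \<le> (\<Sum>k\<le>n. \<bar>b k\<bar> * (2 * (real n)\<^sup>2))"
      using bd by (intro sum_mono) auto
    also have "\<dots> = (\<Sum>k\<le>n. \<bar>b k\<bar>) * (2 * (real n)\<^sup>2)" by (simp add: sum_distrib_right)
    also have "\<dots> \<le> 5 * exp 2 * (2 * (real n)\<^sup>2)" using b by (intro mult_right_mono) auto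
    finally show ?thesis by simp
  qed
  show ?thesis
  proof (rule that[of e w])
    show "0 \<le> e k \<and> e k \<le> 1" if "k \<le> Suc n" for k
      using d[of k] dpos[of k] by (auto simp: e_def)
    have "(\<Sum>k\<le>Suc n. \<bar>w k\<bar>) = (\<Sum>k\<le>n. \<bar>b k / d k\<bar>) + \<bar>\<Sum>k\<le>n. b k / d k\<bar>"
      by (simp add: w_def)
    also have "\<dots> \<le> (\<Sum>k\<le>n. \<bar>b k / d k\<bar>) + (\<Sum>k\<le>n. \<bar>b k / d k\<bar>)"
      by (intro add_left_mono sum_abs)
    finally show "(\<Sum>k\<le>Suc n. \<bar>w k\<bar>) \<le> 20 * exp 2 * (real n)\<^sup>2" using S by simp
    fix p :: "real poly" assume deg: "degree p \<le> n"
    obtain a g where p: "p = pCons a g" by (cases p)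
    have "degree g \<le> n" using deg p by (cases "g = 0") auto
    then have "coeff p 1 = (\<Sum>k\<le>n. b k * poly g (d k))"
      using q[of g] by (simp add: p poly_0_coeff_0)
    also have "\<dots> = (\<Sum>k\<le>n. b k / d k * poly p (d k) - b k / d k * a)"
    proof (intro sum.cong)
      fix k assume "k \<in> {..n}"
      then have "d k > 0" using dpos by simp
      then show "b k * poly g (d k) = b k / d k * poly p (d k) - b k / d k * a"
        by (simp add: p field_simps)
    qed auto
    also have "\<dots> = (\<Sum>k\<le>Suc n. w k * poly p (e k))"
      by (simp add: w_def e_def p sum_subtractf sum_distrib_right)
    finally show "coeff p 1 = (\<Sum>k\<le>Suc n. w k * poly p (e k))" .
  qed
qed

subsection \<open>Translates and polynomials in the plane\<close>

text \<open>For positive points this is \<open>powr_convex\<close>; if one point is 0, it reduces to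
  s^p \<le> s for 0 < s < 1.\<close>

lemma convex_on_powr_nonneg:
  assumes "p \<ge> 1"
  shows "convex_on {0::real..} (\<lambda>x. x powr p)"
proof (rule convex_onI)
  fix t x y :: real
  assume t: "0 < t" "t < 1" and xy: "x \<in> {0..}" "y \<in> {0..}"
  have scale: "(s * z) powr p \<le> s * z powr p" if "0 < s" "s < 1" "z \<ge> 0" for s z :: real
  proof -
    have "s powr p \<le> s" using that assms powr_mono'[of 1 p s] by simp
    then show ?thesis using that by (simp add: powr_mult mult_right_mono)
  qed
  consider "x = 0" | "y = 0" | "x > 0" "y > 0" using xy by force
  then show "((1 - t) *\<^sub>R x + t *\<^sub>R y) powr p \<le> (1 - t) * x powr p + t * y powr p"
  proof cases
    case 1
    then show ?thesis using scale[of t y] t xy assms by simp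
  next
    case 2
    then show ?thesis using scale[of "1 - t" x] t xy assms by simp
  next
    case 3
    then show ?thesis using convex_onD[OF powr_convex[OF assms], of t x y] t by simp
  qed
qed auto

text \<open>Jensen's inequality for the probability weights |b k| / S, where S is the sum of the |b
  k|.\<close>

lemma abs_sum_powr_le:
  fixes b u :: "'i \<Rightarrow> real"
  assumes "p \<ge> 1" "finite I" "(\<Sum>k\<in>I. \<bar>b k\<bar>) \<le> B" "B > 0"
  shows "\<bar>\<Sum>k\<in>I. b k * u k\<bar> powr p \<le> B powr (p - 1) * (\<Sum>k\<in>I. \<bar>b k\<bar> * \<bar>u k\<bar> powr p)"
proof (cases "(\<Sum>k\<in>I. \<bar>b k\<bar>) = 0")
  case True
  then have "\<forall>k\<in>I. b k = 0" using assms(2) by (simp add: sum_nonneg_eq_0_iff)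
  then show ?thesis using assms by (simp add: sum_nonneg)
next
  case False
  define S where "S = (\<Sum>k\<in>I. \<bar>b k\<bar>)"
  have S: "S > 0" using False unfolding S_def by (metis abs_ge_zero sum_nonneg less_eq_real_def)
  have "\<bar>\<Sum>k\<in>I. b k * u k\<bar> \<le> (\<Sum>k\<in>I. \<bar>b k\<bar> * \<bar>u k\<bar>)"
    by (rule order_trans[OF sum_abs]) (simp add: abs_mult)
  also have "\<dots> = S * (\<Sum>k\<in>I. (\<bar>b k\<bar> / S) *\<^sub>R \<bar>u k\<bar>)"
    using S by (simp add: sum_distrib_left)
  finally have "\<bar>\<Sum>k\<in>I. b k * u k\<bar> powr p \<le> (S * (\<Sum>k\<in>I. (\<bar>b k\<bar> / S) *\<^sub>R \<bar>u k\<bar>)) powr p"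
    using assms(1) by (intro powr_mono2) auto
  also have "\<dots> = S powr p * (\<Sum>k\<in>I. (\<bar>b k\<bar> / S) *\<^sub>R \<bar>u k\<bar>) powr p"
    by (rule powr_mult)
  also have "\<dots> \<le> S powr p * (\<Sum>k\<in>I. (\<bar>b k\<bar> / S) * \<bar>u k\<bar> powr p)"
  proof (intro mult_left_mono convex_on_sum[OF _ _ convex_on_powr_nonneg[OF assms(1)]])
    show "I \<noteq> {}" using S by (auto simp: S_def)
    show "(\<Sum>k\<in>I. \<bar>b k\<bar> / S) = 1" using S by (simp add: S_def flip: sum_divide_distrib)
  qed (use assms S in auto)
  also have "\<dots> = S powr (p - 1) * (\<Sum>k\<in>I. \<bar>b k\<bar> * \<bar>u k\<bar> powr p)"
    using S by (simp add: powr_diff sum_distrib_left)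
  also have "\<dots> \<le> B powr (p - 1) * (\<Sum>k\<in>I. \<bar>b k\<bar> * \<bar>u k\<bar> powr p)"
    using S assms(1,3) by (intro mult_right_mono powr_mono2 sum_nonneg) (auto simp: S_def)
  finally show ?thesis .
qed

text \<open>The p-th power of the norm, as an extended nonnegative integral: monotonicity and
  additivity then need measurability but no integrability.\<close>

definition mass :: "real \<Rightarrow> (real \<times> real) set \<Rightarrow> (real \<times> real \<Rightarrow> real) \<Rightarrow> ennreal" where
  "mass p S f = (\<integral>\<^sup>+z. ennreal (\<bar>f z\<bar> powr p) * indicator S z \<partial>lborel)"

lemma mass_cong: "(\<And>z. z \<in> S \<Longrightarrow> f z = g z) \<Longrightarrow> mass p S f = mass p S g"
  unfolding mass_def by (intro nn_integral_cong) (auto split: split_indicator)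

lemma mass_Un_le:
  assumes [measurable]: "S \<in> sets borel" "T \<in> sets borel" "f \<in> borel_measurable borel"
  shows "mass p (S \<union> T) f \<le> mass p S f + mass p T f"
proof -
  have "mass p (S \<union> T) f \<le> (\<integral>\<^sup>+z. ennreal (\<bar>f z\<bar> powr p) * indicator S z
      + ennreal (\<bar>f z\<bar> powr p) * indicator T z \<partial>lborel)"
    unfolding mass_def by (intro nn_integral_mono) (auto split: split_indicator)
  also have "\<dots> = mass p S f + mass p T f"
    unfolding mass_def by (subst nn_integral_add) auto
  finally show ?thesis .
qed

lemma mass_translate_le:
  assumes [measurable]: "S \<in> sets borel" "T \<in> sets borel" "f \<in> borel_measurable borel"
    and sub: "\<And>z. z \<in> S \<Longrightarrow> z + v \<in> T"
  shows "mass p S (\<lambda>z. f (z + v)) \<le> mass p T f"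
proof -
  have "mass p S (\<lambda>z. f (z + v)) \<le> (\<integral>\<^sup>+z. ennreal (\<bar>f (v + z)\<bar> powr p) * indicator T (v + z) \<partial>lborel)"
    unfolding mass_def using sub
    by (intro nn_integral_mono) (auto split: split_indicator simp: add.commute)
  also have "\<dots> = (\<integral>\<^sup>+z. ennreal (\<bar>f z\<bar> powr p) * indicator T z \<partial>distr lborel borel ((+) v))"
    by (subst nn_integral_distr) auto
  also have "\<dots> = mass p T f"
    unfolding mass_def lborel_distr_plus by simp
  finally show ?thesis .
qed

text \<open>Stands in for Minkowski's inequality: after p-th roots, a combination with coefficients
  of l^1-norm at most \<open>B\<close> has norm at most \<open>B\<close> times a common bound. It
  follows by integrating \<open>abs_sum_powr_le\<close>.\<close>

lemma mass_sum_le: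
  fixes f :: "'i \<Rightarrow> real \<times> real \<Rightarrow> real"
  assumes p: "p \<ge> 1" and fin: "finite I" and b: "(\<Sum>k\<in>I. \<bar>b k\<bar>) \<le> B" "B > 0"
    and [measurable]: "S \<in> sets borel" "\<And>k. k \<in> I \<Longrightarrow> f k \<in> borel_measurable borel"
    and X: "\<And>k. k \<in> I \<Longrightarrow> mass p S (f k) \<le> X"
  shows "mass p S (\<lambda>z. \<Sum>k\<in>I. b k * f k z) \<le> ennreal (B powr p) * X"
proof -
  have "mass p S (\<lambda>z. \<Sum>k\<in>I. b k * f k z)
    \<le> (\<integral>\<^sup>+z. (\<Sum>k\<in>I. ennreal (B powr (p - 1) * \<bar>b k\<bar>) * (ennreal (\<bar>f k z\<bar> powr p) * indicator S z)) \<partial>lborel)"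
    unfolding mass_def
  proof (rule nn_integral_mono)
    fix z
    have "ennreal (\<bar>\<Sum>k\<in>I. b k * f k z\<bar> powr p)
      \<le> ennreal (\<Sum>k\<in>I. (B powr (p - 1) * \<bar>b k\<bar>) * \<bar>f k z\<bar> powr p)"
      using abs_sum_powr_le[OF p fin b, of "\<lambda>k. f k z"]
      by (intro ennreal_leI) (simp add: sum_distrib_left mult.assoc)
    also have "\<dots> = (\<Sum>k\<in>I. ennreal ((B powr (p - 1) * \<bar>b k\<bar>) * \<bar>f k z\<bar> powr p))"
      by (rule sum_ennreal[symmetric]) simp
    finally show "ennreal (\<bar>\<Sum>k\<in>I. b k * f k z\<bar> powr p) * indicator S z
      \<le> (\<Sum>k\<in>I. ennreal (B powr (p - 1) * \<bar>b k\<bar>) * (ennreal (\<bar>f k z\<bar> powr p) * indicator S z))"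
      by (auto split: split_indicator simp: ennreal_mult)
  qed
  also have "\<dots> = (\<Sum>k\<in>I. ennreal (B powr (p - 1) * \<bar>b k\<bar>) * mass p S (f k))"
    unfolding mass_def by (subst nn_integral_sum) (auto simp: nn_integral_cmult)
  also have "\<dots> \<le> (\<Sum>k\<in>I. ennreal (B powr (p - 1) * \<bar>b k\<bar>) * X)"
    using X by (intro sum_mono mult_left_mono) auto
  also have "\<dots> = ennreal (\<Sum>k\<in>I. B powr (p - 1) * \<bar>b k\<bar>) * X"
    by (simp add: sum_ennreal flip: sum_distrib_right)
  also have "\<dots> \<le> ennreal (B powr p) * X"
  proof (intro mult_right_mono ennreal_leI)
    have "(\<Sum>k\<in>I. B powr (p - 1) * \<bar>b k\<bar>) \<le> B powr (p - 1) * B"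
      unfolding sum_distrib_left[symmetric] using b by (intro mult_left_mono) auto
    also have "\<dots> = B powr p" using b(2) by (simp add: powr_diff)
    finally show "(\<Sum>k\<in>I. B powr (p - 1) * \<bar>b k\<bar>) \<le> B powr p" .
  qed auto
  finally show ?thesis .
qed

section \<open>Polynomial functions of two variables and their restrictions to lines\<close>

lemma finite_degree_pairs: "finite {(i, j). i + j \<le> (n::nat)}"
  by (rule finite_subset[of _ "{..n} \<times> {..n}"]) auto

lemma poly2_deg_le_monomial:
  assumes "i + j \<le> n"
  shows "(\<lambda>(x, y). a * x ^ i * y ^ j) \<in> poly2_deg_le n"
proof -
  define c where "c = (\<lambda>i' j'. if i' = i \<and> j' = j then a else 0)"
  have "(\<Sum>(i', j') \<in> {(i, j). i + j \<le> n}. c i' j' * x ^ i' * y ^ j') = a * x ^ i * y ^ j" for x y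
  proof -
    have "(\<Sum>(i', j') \<in> {(i, j). i + j \<le> n}. c i' j' * x ^ i' * y ^ j')
      = (\<Sum>q \<in> {(i, j). i + j \<le> n}. if q = (i, j) then a * x ^ i * y ^ j else 0)"
      by (intro sum.cong) (auto simp: c_def split: if_splits)
    also have "\<dots> = a * x ^ i * y ^ j"
      using assms finite_degree_pairs[of n] by (subst sum.delta) auto
    finally show ?thesis .
  qed
  then show ?thesis unfolding poly2_deg_le_def by (auto intro!: exI[of _ c])
qed

lemma poly2_deg_le_add:
  assumes "P \<in> poly2_deg_le n" "Q \<in> poly2_deg_le n"
  shows "(\<lambda>z. P z + Q z) \<in> poly2_deg_le n"
proof -
  obtain c d where c: "\<And>x y. P (x, y) = (\<Sum>(i, j) \<in> {(i, j). i + j \<le> n}. c i j * x ^ i * y ^ j)"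
    and d: "\<And>x y. Q (x, y) = (\<Sum>(i, j) \<in> {(i, j). i + j \<le> n}. d i j * x ^ i * y ^ j)"
    using assms unfolding poly2_deg_le_def by auto
  show ?thesis unfolding poly2_deg_le_def
    by (auto intro!: exI[of _ "\<lambda>i j. c i j + d i j"] simp: c d case_prod_unfold ring_distribs sum.distrib)
qed

lemma poly2_deg_le_sum:
  assumes "\<And>i. i \<in> I \<Longrightarrow> f i \<in> poly2_deg_le n"
  shows "(\<lambda>z. \<Sum>i\<in>I. f i z) \<in> poly2_deg_le n"
  using assms
proof (induction I rule: infinite_finite_induct)
  case (insert x F)
  then show ?case using poly2_deg_le_add[of "f x" n "\<lambda>z. \<Sum>i\<in>F. f i z"] by simp
qed (use poly2_deg_le_monomial[of 0 0 n 0] in \<open>auto simp: case_prod_unfold\<close>)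

lemma poly2_deg_le_cmult:
  assumes "P \<in> poly2_deg_le n"
  shows "(\<lambda>z. a * P z) \<in> poly2_deg_le n"
proof -
  obtain c where c: "\<And>x y. P (x, y) = (\<Sum>(i, j) \<in> {(i, j). i + j \<le> n}. c i j * x ^ i * y ^ j)"
    using assms unfolding poly2_deg_le_def by auto
  show ?thesis unfolding poly2_deg_le_def
    by (auto intro!: exI[of _ "\<lambda>i j. a * c i j"] simp: c case_prod_unfold sum_distrib_left mult.assoc)
qed

lemma continuous_on_poly2:
  assumes "P \<in> poly2_deg_le n"
  shows "continuous_on A P"
proof -
  obtain c where "\<And>x y. P (x, y) = (\<Sum>(i, j) \<in> {(i, j). i + j \<le> n}. c i j * x ^ i * y ^ j)"
    using assms unfolding poly2_deg_le_def by auto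
  then have "P = (\<lambda>z. \<Sum>(i, j) \<in> {(i, j). i + j \<le> n}. c i j * fst z ^ i * snd z ^ j)"
    by auto
  moreover have "continuous_on A \<dots>"
    unfolding case_prod_unfold by (intro continuous_intros)
  ultimately show ?thesis by simp
qed

lemma poly2_measurable: "P \<in> poly2_deg_le n \<Longrightarrow> P \<in> borel_measurable borel"
  by (intro borel_measurable_continuous_onI continuous_on_poly2)

text \<open>The derivative along an arbitrary direction is computed termwise; the directions (1, 0)
  and (0, 1) then identify the two partial derivatives.\<close>

lemma poly2_partials:
  assumes "P \<in> poly2_deg_le n"
  shows "partial_x P \<in> poly2_deg_le n" "partial_y P \<in> poly2_deg_le n"
    and "((\<lambda>t. P (x + t * a, y + t * b)) has_real_derivative
           a * partial_x P (x, y) + b * partial_y P (x, y)) (at 0)"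
proof -
  define T where "T = {(i, j). i + j \<le> (n::nat)}"
  obtain c where c: "\<And>x y. P (x, y) = (\<Sum>(i, j) \<in> T. c i j * x ^ i * y ^ j)"
    using assms unfolding poly2_deg_le_def T_def by auto
  \<comment> \<open>The truncated exponent \<open>fst q - 1\<close> is harmless at 0, because the
    factor \<open>real (fst q)\<close> vanishes there; likewise in \<open>Py\<close>.\<close>
  define Px where "Px = (\<lambda>z. \<Sum>q \<in> T. (\<lambda>(x, y). (c (fst q) (snd q) * real (fst q)) * x ^ (fst q - 1) * y ^ snd q) z)"
  define Py where "Py = (\<lambda>z. \<Sum>q \<in> T. (\<lambda>(x, y). (c (fst q) (snd q) * real (snd q)) * x ^ fst q * y ^ (snd q - 1)) z)"
  have "Px \<in> poly2_deg_le n" "Py \<in> poly2_deg_le n"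
    unfolding Px_def Py_def by (auto intro!: poly2_deg_le_sum poly2_deg_le_monomial simp: T_def)
  have D: "((\<lambda>t. P (x + t * a, y + t * b)) has_real_derivative
           a * Px (x, y) + b * Py (x, y)) (at 0)" for x y a b
  proof -
    have "((\<lambda>t. \<Sum>q\<in>T. c (fst q) (snd q) * (x + t * a) ^ fst q * (y + t * b) ^ snd q) has_real_derivative
       (\<Sum>q\<in>T. c (fst q) (snd q) * (real (fst q) * x ^ (fst q - 1) * a * y ^ snd q
           + x ^ fst q * (real (snd q) * y ^ (snd q - 1) * b)))) (at 0)"
      by (rule DERIV_sum) (auto intro!: derivative_eq_intros simp: algebra_simps)
    moreover have "(\<Sum>q\<in>T. c (fst q) (snd q) * (real (fst q) * x ^ (fst q - 1) * a * y ^ snd q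
           + x ^ fst q * (real (snd q) * y ^ (snd q - 1) * b))) = a * Px (x, y) + b * Py (x, y)"
      by (simp add: Px_def Py_def sum_distrib_left sum.distrib algebra_simps)
    ultimately show ?thesis by (simp add: c case_prod_unfold)
  qed
  have "partial_x P = Px"
  proof (intro ext)
    fix z :: "real \<times> real"
    have "((\<lambda>t. P (t, snd z)) has_real_derivative Px z) (at (fst z))"
      using D[of "fst z" 1 "snd z" 0] DERIV_shift[of "\<lambda>t. P (t, snd z)" "Px z" 0 "fst z"] by (simp add: add.commute)
    then show "partial_x P z = Px z"
      by (simp add: partial_x_def case_prod_unfold DERIV_imp_deriv)
  qed
  moreover have "partial_y P = Py"
  proof (intro ext)
    fix z :: "real \<times> real"
    have "((\<lambda>t. P (fst z, t)) has_real_derivative Py z) (at (snd z))"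
      using D[of "fst z" 0 "snd z" 1] DERIV_shift[of "\<lambda>t. P (fst z, t)" "Py z" 0 "snd z"] by (simp add: add.commute)
    then show "partial_y P z = Py z"
      by (simp add: partial_y_def case_prod_unfold DERIV_imp_deriv)
  qed
  ultimately show "partial_x P \<in> poly2_deg_le n" "partial_y P \<in> poly2_deg_le n"
    "((\<lambda>t. P (x + t * a, y + t * b)) has_real_derivative
           a * partial_x P (x, y) + b * partial_y P (x, y)) (at 0)"
    using D \<open>Px \<in> _\<close> \<open>Py \<in> _\<close> by auto
qed

text \<open>Connects the plane with the one-variable functionals: evaluation and directional
  derivative at \<open>z\<close> become the value and the linear coefficient of \<open>q\<close> at
  0.\<close>

lemma poly2_restrict_line:
  assumes "P \<in> poly2_deg_le n"
  obtains q where "degree q \<le> n" "\<And>t. P (z + t *\<^sub>R v) = poly q t"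
    "coeff q 1 = fst v * partial_x P z + snd v * partial_y P z"
proof -
  define T where "T = {(i, j). i + j \<le> (n::nat)}"
  obtain c where c: "\<And>x y. P (x, y) = (\<Sum>(i, j) \<in> T. c i j * x ^ i * y ^ j)"
    using assms unfolding poly2_deg_le_def T_def by auto
  define q where "q = (\<Sum>(i, j) \<in> T. Polynomial.smult (c i j) ([:fst z, fst v:] ^ i * [:snd z, snd v:] ^ j))"
  have deg1: "degree ([:a, b:] ^ k) \<le> k" for a b :: real and k
    by (rule order_trans[OF degree_power_le]) simp
  have deg: "degree q \<le> n"
    unfolding q_def case_prod_unfold
  proof (rule degree_sum_le)
    show "finite T" unfolding T_def by (rule finite_degree_pairs)
    fix r assume "r \<in> T"
    then have "degree ([:fst z, fst v:] ^ fst r) + degree ([:snd z, snd v:] ^ snd r) \<le> n"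
      using deg1[of "fst z" "fst v" "fst r"] deg1[of "snd z" "snd v" "snd r"] by (auto simp: T_def)
    then show "degree (Polynomial.smult (c (fst r) (snd r)) ([:fst z, fst v:] ^ fst r * [:snd z, snd v:] ^ snd r)) \<le> n"
      using degree_smult_le degree_mult_le order_trans by meson
  qed
  have P: "P (z + t *\<^sub>R v) = poly q t" for t
    by (cases z; cases v) (simp add: c q_def poly_sum case_prod_unfold poly_power mult.assoc)
  have "((\<lambda>t. poly q t) has_real_derivative poly (pderiv q) 0) (at 0)"
    by (rule poly_DERIV)
  moreover have "((\<lambda>t. poly q t) has_real_derivative fst v * partial_x P z + snd v * partial_y P z) (at 0)"
    using poly2_partials(3)[OF assms, of "fst z" "fst v" "snd z" "snd v"] P
    by (cases z; cases v) simp
  ultimately have "poly (pderiv q) 0 = fst v * partial_x P z + snd v * partial_y P z"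
    by (rule DERIV_unique)
  then have "coeff q 1 = fst v * partial_x P z + snd v * partial_y P z"
    by (simp add: poly_0_coeff_0 coeff_pderiv)
  then show ?thesis using that deg P by blast
qed

text \<open>The nodes and weights of \<open>derivative_functional\<close> do not depend on
  \<open>z\<close>, so the derivative is one fixed combination of translates of \<open>P\<close>.
  The length of the admissible step is absorbed into \<open>v\<close>.\<close>

lemma mass_directional_derivative_le:
  assumes p: "p \<ge> 1" and n: "n \<ge> 1" and P: "P \<in> poly2_deg_le n"
    and [measurable]: "E \<in> sets borel" "S \<in> sets borel"
    and seg: "\<And>z t. z \<in> E \<Longrightarrow> 0 \<le> t \<Longrightarrow> t \<le> 1 \<Longrightarrow> z + t *\<^sub>R v \<in> S"
  shows "mass p E (\<lambda>z. fst v * partial_x P z + snd v * partial_y P z)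
    \<le> ennreal ((20 * exp 2 * (real n)\<^sup>2) powr p) * mass p S P"
proof (rule derivative_functional[OF n])
  fix w d :: "nat \<Rightarrow> real"
  assume d: "\<And>k. k \<le> Suc n \<Longrightarrow> 0 \<le> d k \<and> d k \<le> 1"
    and w: "(\<Sum>k\<le>Suc n. \<bar>w k\<bar>) \<le> 20 * exp 2 * (real n)\<^sup>2"
    and q: "\<And>q :: real poly. degree q \<le> n \<Longrightarrow> coeff q 1 = (\<Sum>k\<le>Suc n. w k * poly q (d k))"
  have [measurable]: "P \<in> borel_measurable borel" using P by (rule poly2_measurable)
  have "fst v * partial_x P z + snd v * partial_y P z = (\<Sum>k\<le>Suc n. w k * P (z + d k *\<^sub>R v))" for z
  proof (rule poly2_restrict_line[OF P, of z v])
    fix r assume r: "degree r \<le> n" "\<And>t. P (z + t *\<^sub>R v) = poly r t"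
      and e: "coeff r 1 = fst v * partial_x P z + snd v * partial_y P z"
    show ?thesis unfolding e[symmetric] q[OF r(1)] r(2) ..
  qed
  then have "mass p E (\<lambda>z. fst v * partial_x P z + snd v * partial_y P z)
    = mass p E (\<lambda>z. \<Sum>k\<le>Suc n. w k * P (z + d k *\<^sub>R v))" by simp
  also have "\<dots> \<le> ennreal ((20 * exp 2 * (real n)\<^sup>2) powr p) * mass p S P"
    by (intro mass_sum_le[OF p _ w] mass_translate_le) (use n d seg in auto)
  finally show ?thesis .
qed

text \<open>Here the segment has to lie in \<open>S\<close> only from parameter 1/(2n^2) onwards, so
  \<open>E\<close> itself may lie outside \<open>S\<close>. The constant is independent of the
  degree.\<close>

lemma mass_extrapolate_le:
  assumes p: "p \<ge> 1" and n: "n \<ge> 1" and P: "P \<in> poly2_deg_le n"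
    and [measurable]: "E \<in> sets borel" "S \<in> sets borel"
    and seg: "\<And>z t. z \<in> E \<Longrightarrow> 1 / (2 * (real n)\<^sup>2) \<le> t \<Longrightarrow> t \<le> 1 \<Longrightarrow> z + t *\<^sub>R v \<in> S"
  shows "mass p E P \<le> ennreal ((5 * exp 2) powr p) * mass p S P"
proof (rule extrapolation_functional[OF n])
  fix w d :: "nat \<Rightarrow> real"
  assume d: "\<And>k. k \<le> n \<Longrightarrow> 1 / (2 * (real n)\<^sup>2) \<le> d k \<and> d k \<le> 1"
    and w: "(\<Sum>k\<le>n. \<bar>w k\<bar>) \<le> 5 * exp 2"
    and q: "\<And>q :: real poly. degree q \<le> n \<Longrightarrow> poly q 0 = (\<Sum>k\<le>n. w k * poly q (d k))"
  have [measurable]: "P \<in> borel_measurable borel" using P by (rule poly2_measurable)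
  have "P z = (\<Sum>k\<le>n. w k * P (z + d k *\<^sub>R v))" for z
  proof (rule poly2_restrict_line[OF P, of z v])
    fix r assume r: "degree r \<le> n" "\<And>t. P (z + t *\<^sub>R v) = poly r t"
    have "P z = poly r 0" using r(2)[of 0] by simp
    then show ?thesis unfolding r(2) q[OF r(1)] .
  qed
  then have "mass p E P = mass p E (\<lambda>z. \<Sum>k\<le>n. w k * P (z + d k *\<^sub>R v))" by (intro mass_cong)
  also have "\<dots> \<le> ennreal ((5 * exp 2) powr p) * mass p S P"
    by (intro mass_sum_le[OF p _ w] mass_translate_le) (use n d seg in auto)
  finally show ?thesis .
qed

text \<open>Nearly parallel directions \<open>u\<close> and \<open>v\<close> force large
  coefficients; this is where the angle at the cusp enters, through \<open>B\<close>.\<close>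

lemma mass_partial_le:
  assumes p: "p \<ge> 1" and n: "n \<ge> 1" and P: "P \<in> poly2_deg_le n"
    and [measurable]: "E \<in> sets borel" "S \<in> sets borel"
    and seg: "\<And>z t. z \<in> E \<Longrightarrow> 0 \<le> t \<Longrightarrow> t \<le> 1 \<Longrightarrow> z + t *\<^sub>R u \<in> S"
      "\<And>z t. z \<in> E \<Longrightarrow> 0 \<le> t \<Longrightarrow> t \<le> 1 \<Longrightarrow> z + t *\<^sub>R v \<in> S"
    and e: "e = \<alpha> *\<^sub>R u + \<beta> *\<^sub>R v" and B: "\<bar>\<alpha>\<bar> + \<bar>\<beta>\<bar> \<le> B" "B > 0"
  shows "mass p E (\<lambda>z. fst e * partial_x P z + snd e * partial_y P z)
    \<le> ennreal ((B * (20 * exp 2 * (real n)\<^sup>2)) powr p) * mass p S P"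
proof -
  define g where "g k = (if k then u else v)" for k
  define c where "c k = (if k then \<alpha> else \<beta>)" for k
  have [measurable]: "partial_x P \<in> borel_measurable borel" "partial_y P \<in> borel_measurable borel"
    using poly2_partials[OF P] poly2_measurable by auto
  have "mass p E (\<lambda>z. fst e * partial_x P z + snd e * partial_y P z)
     = mass p E (\<lambda>z. \<Sum>k\<in>UNIV. c k * (fst (g k) * partial_x P z + snd (g k) * partial_y P z))"
    by (simp add: UNIV_bool c_def g_def e algebra_simps)
  also have "\<dots> \<le> ennreal (B powr p) * (ennreal ((20 * exp 2 * (real n)\<^sup>2) powr p) * mass p S P)"
  proof (intro mass_sum_le[OF p])
    show "mass p E (\<lambda>z. fst (g k) * partial_x P z + snd (g k) * partial_y P z)
      \<le> ennreal ((20 * exp 2 * (real n)\<^sup>2) powr p) * mass p S P" for k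
      by (intro mass_directional_derivative_le[OF p n P]) (use seg in \<open>auto simp: g_def\<close>)
  qed (use B in \<open>auto simp: UNIV_bool c_def\<close>)
  also have "\<dots> = ennreal ((B * (20 * exp 2 * (real n)\<^sup>2)) powr p) * mass p S P"
    using B by (simp add: powr_mult ennreal_mult mult.assoc)
  finally show ?thesis .
qed

subsection \<open>The Markov inequality with exponent 4\<close>

text \<open>If the mass is infinite, both sides are 0: the Bochner integral defaults to 0, and
  \<open>enn2real\<close> sends infinity to 0.\<close>

lemma Lp_norm_eq_mass:
  assumes [measurable]: "S \<in> sets borel" "f \<in> borel_measurable borel"
  shows "Lp_norm p S f = enn2real (mass p S f) powr (1 / p)"
proof -
  have "(LINT z:S|lborel. \<bar>f z\<bar> powr p) = enn2real (\<integral>\<^sup>+z. ennreal (indicator S z *\<^sub>R (\<bar>f z\<bar> powr p)) \<partial>lborel)"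
    unfolding set_lebesgue_integral_def by (intro integral_eq_nn_integral) auto
  also have "(\<integral>\<^sup>+z. ennreal (indicator S z *\<^sub>R (\<bar>f z\<bar> powr p)) \<partial>lborel) = mass p S f"
    unfolding mass_def by (intro nn_integral_cong) (auto split: split_indicator)
  finally show ?thesis by (simp add: Lp_norm_def)
qed

lemma mass_poly2_finite:
  assumes P: "P \<in> poly2_deg_le n" and S: "bounded S" "S \<in> sets borel" and p: "p \<ge> 0"
  shows "mass p S P < \<infinity>"
proof -
  define K where "K = closure S"
  have K: "compact K" "S \<subseteq> K"
    using S(1) by (auto simp: K_def closure_subset)
  have "compact (P ` K)"
    using K(1) continuous_on_poly2[OF P] compact_continuous_image by blast
  then obtain B where B: "\<And>z. z \<in> K \<Longrightarrow> \<bar>P z\<bar> \<le> B"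
    using compact_imp_bounded[of "P ` K"] unfolding bounded_iff by auto
  have "mass p S P \<le> (\<integral>\<^sup>+z. ennreal (B powr p) * indicator S z \<partial>lborel)"
    unfolding mass_def using B K(2) p
    by (intro nn_integral_mono) (auto split: split_indicator intro!: ennreal_leI powr_mono2)
  also have "\<dots> = ennreal (B powr p) * emeasure lborel S"
    using S(2) by (intro nn_integral_cmult_indicator) simp
  also have "\<dots> < \<infinity>"
    using emeasure_bounded_finite[OF S(1)] by (auto simp: ennreal_mult_less_top)
  finally show ?thesis .
qed

section \<open>Geometry of the domain and estimates on its pieces\<close>

lemma Omega_measurable [measurable]: "Omega \<in> sets borel"
proof -
  have "Omega = {z. \<bar>fst z\<bar> < 2 \<and> \<bar>fst z\<bar> < snd z + 1 \<and> (fst z)\<^sup>2 > 4 * snd z}"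
    unfolding Omega_def by auto
  also have "\<dots> \<in> sets borel"
    by (intro borel_open open_Collect_conj open_Collect_less continuous_intros)
  finally show ?thesis .
qed

lemma borel_measurable_fst_snd [measurable]:
  "fst \<in> borel_measurable (borel :: (real \<times> real) measure)"
  "snd \<in> borel_measurable (borel :: (real \<times> real) measure)"
  by (auto intro!: borel_measurable_continuous_onI continuous_intros)

lemma sets_Collect_mem:
  assumes "S \<in> sets M" "Measurable.pred M Q"
  shows "{z \<in> S. Q z} \<in> sets M"
proof -
  have "{z \<in> S. Q z} = S \<inter> {z \<in> space M. Q z}" using sets.sets_into_space[OF assms(1)] by auto
  then show ?thesis using assms by (auto simp: pred_def)
qed

lemma mem_Omega_iff: "z \<in> Omega \<longleftrightarrow> \<bar>fst z\<bar> < 2 \<and> \<bar>fst z\<bar> < snd z + 1 \<and> (fst z)\<^sup>2 > 4 * snd z"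
  unfolding Omega_def by (cases z) auto

text \<open>The slopes \<open>m\<close> between \<open>\<bar>x\<bar> / 2\<close> (the tangent of the parabola) and \<open>1\<close> are those along which
  one can move away from the nearer cusp.\<close>

lemma Omega_segment:
  assumes z: "z \<in> Omega" and s: "\<bar>s\<bar> = 1" "1 / 2 \<le> s * fst z" and m: "0 \<le> m" "m \<le> 1" "s * fst z \<le> 2 * m"
    and r: "0 \<le> r" "r \<le> 1 / 2"
  shows "z + r *\<^sub>R (- s, - m) \<in> Omega"
proof -
  have a: "\<bar>fst z\<bar> = s * fst z" "\<bar>fst z - r * s\<bar> = s * fst z - r"
    using s r by (auto simp: abs_if split: if_splits)
  have "m * r \<le> 1 * r" using m r by (intro mult_right_mono)
  moreover have "s * s = 1" using s(1) by (auto simp: abs_if split: if_splits)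
  then have "(fst z - r * s)\<^sup>2 = (fst z)\<^sup>2 - 2 * (s * fst z) * r + r\<^sup>2"
    by (simp add: power2_eq_square algebra_simps)
  \<comment> \<open>Along the segment 4y drops by 4mr, while x^2 drops by at most 2(sx)r \<le> 4mr.
    This is the use of the slope condition.\<close>
  moreover have "(s * fst z) * r \<le> (2 * m) * r" using m r by (intro mult_right_mono)
  moreover have "4 * snd z < (fst z)\<^sup>2" using z by (simp add: mem_Omega_iff)
  ultimately have "4 * snd z - 4 * (m * r) < (fst z - r * s)\<^sup>2"
    using zero_le_power2[of r] by linarith
  then show ?thesis
    using z a r \<open>m * r \<le> 1 * r\<close> by (auto simp: mem_Omega_iff algebra_simps)
qed

text \<open>The sign \<open>s\<close> selects the cusp (2s, 1). On \<open>E\<close>, away from the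
  cusp, two directions are available; the derivative on the remaining piece \<open>Z\<close> is
  extrapolated from \<open>E\<close>.\<close>

lemma mass_Omega_near_cusp_le:
  assumes p: "p \<ge> 1" and n: "n \<ge> 1" and P: "P \<in> poly2_deg_le n" and s: "\<bar>s\<bar> = 1"
    and e: "\<bar>fst e\<bar> \<le> 1" "\<bar>snd e\<bar> \<le> 1"
  defines "D \<equiv> \<lambda>z. fst e * partial_x P z + snd e * partial_y P z"
  shows "mass p {z \<in> Omega. 1 / 2 \<le> s * fst z} D
    \<le> 2 * (ennreal ((10000 * exp 4 * (real n) ^ 4) powr p) * mass p Omega P)"
proof -
  \<comment> \<open>Chosen so that 4\<theta> = 1/(2n^2), the least extrapolation parameter: along
    half the vector (-s, -1) it moves sx by 2\<theta>, just enough to pass from \<open>Z\<close> to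
    \<open>E\<close>.\<close>
  define \<theta> where "\<theta> = 1 / (8 * (real n)\<^sup>2)"
  have n2: "(real n)\<^sup>2 \<ge> 1" using n by simp
  then have "1 / (8 * (real n)\<^sup>2) \<le> 1 / (8 * 1)" using n by (intro divide_left_mono) auto
  then have \<theta>: "0 < \<theta>" "\<theta> \<le> 1 / 8" using n unfolding \<theta>_def by auto
  define E where "E = {z \<in> Omega. 1 / 2 \<le> s * fst z \<and> s * fst z \<le> 2 - 2 * \<theta>}"
  define Z where "Z = {z \<in> Omega. 2 - 2 * \<theta> < s * fst z}"
  have [measurable]: "E \<in> sets borel" "Z \<in> sets borel"
    unfolding E_def Z_def by (auto intro!: sets_Collect_mem)
  have "D \<in> poly2_deg_le n"
    unfolding D_def by (intro poly2_deg_le_add poly2_deg_le_cmult poly2_partials[OF P])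
  then have [measurable]: "D \<in> borel_measurable borel" by (rule poly2_measurable)
  have s2: "s * s = 1" using s by (auto simp: abs_if split: if_splits)
  let ?K = "66 * (real n)\<^sup>2 * (20 * exp 2 * (real n)\<^sup>2)"
  have E: "mass p E D \<le> ennreal (?K powr p) * mass p Omega P"
    unfolding D_def
  \<comment> \<open>The factor 1/2 respects the bound on \<open>r\<close> in
    \<open>Omega_segment\<close>. Since -2s \<open>fst e\<close> times u is (\<open>fst e\<close>, s
    \<open>fst e\<close>) and v - u = (0, \<theta>/2), the second coordinate is corrected by a
    multiple of v - u.\<close>
  proof (rule mass_partial_le[OF p n P, where u = "(1 / 2) *\<^sub>R (- s, - 1)" and v = "(1 / 2) *\<^sub>R (- s, - (1 - \<theta>))"
        and \<alpha> = "- 2 * s * fst e - (2 / \<theta>) * (snd e - s * fst e)" and \<beta> = "(2 / \<theta>) * (snd e - s * fst e)"])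
    fix z :: "real \<times> real" and t :: real assume z: "z \<in> E" and t: "0 \<le> t" "t \<le> 1"
    have "s * fst z \<le> 2" using z s by (auto simp: E_def mem_Omega_iff abs_if split: if_splits)
    then show "z + t *\<^sub>R (1 / 2) *\<^sub>R (- s, - 1) \<in> Omega"
      using Omega_segment[of z s 1 "t / 2"] z s t by (simp add: E_def)
    show "z + t *\<^sub>R (1 / 2) *\<^sub>R (- s, - (1 - \<theta>)) \<in> Omega"
      using Omega_segment[of z s "1 - \<theta>" "t / 2"] z s t \<theta> by (simp add: E_def)
  next
    have "s * (s * fst e) = fst e" using s2 by (simp flip: mult.assoc)
    then show "e = (- 2 * s * fst e - (2 / \<theta>) * (snd e - s * fst e)) *\<^sub>R (1 / 2) *\<^sub>R (- s, - 1)
      + ((2 / \<theta>) * (snd e - s * fst e)) *\<^sub>R (1 / 2) *\<^sub>R (- s, - (1 - \<theta>))"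
      using \<theta>(1) by (cases e) (simp add: field_simps)
    define g where "g = snd e - s * fst e"
    have se: "\<bar>s * fst e\<bar> \<le> 1" using e(1) s by (simp add: abs_mult)
    then have g: "\<bar>g\<bar> \<le> 2" using e(2) unfolding g_def by linarith
    have "\<bar>(2 / \<theta>) * g\<bar> = 16 * (real n)\<^sup>2 * \<bar>g\<bar>" unfolding \<theta>_def abs_mult by simp
    also have "\<dots> \<le> 16 * (real n)\<^sup>2 * 2" using g by (intro mult_left_mono) auto
    finally have b: "\<bar>(2 / \<theta>) * g\<bar> \<le> 32 * (real n)\<^sup>2" by simp
    have "\<bar>- 2 * s * fst e - (2 / \<theta>) * g\<bar> \<le> 2 * \<bar>s * fst e\<bar> + \<bar>(2 / \<theta>) * g\<bar>" by linarith
    \<comment> \<open>The sum is at most 2 + 2 * 32n^2, because 2/\<theta> = 16n^2 and |g| \<le>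
      2.\<close>
    then show "\<bar>- 2 * s * fst e - (2 / \<theta>) * (snd e - s * fst e)\<bar> + \<bar>(2 / \<theta>) * (snd e - s * fst e)\<bar>
      \<le> 66 * (real n)\<^sup>2"
      using b se n2 unfolding g_def[symmetric] by linarith
  qed (use n in auto)
  \<comment> \<open>The derivative \<open>D\<close> is again a polynomial of degree at most n, so it
    can be extrapolated itself, along the cusp tangent.\<close>
  have "mass p Z D \<le> ennreal ((5 * exp 2) powr p) * mass p E D"
  proof (rule mass_extrapolate_le[OF p n, where v = "(1 / 2) *\<^sub>R (- s, - 1)"])
    fix z :: "real \<times> real" and t :: real assume z: "z \<in> Z" and t: "1 / (2 * (real n)\<^sup>2) \<le> t" "t \<le> 1"
    have t\<theta>: "4 * \<theta> \<le> t" using t(1) unfolding \<theta>_def by simp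
    have z2: "s * fst z < 2" using z s by (auto simp: Z_def mem_Omega_iff abs_if split: if_splits)
    have "z + t *\<^sub>R (1 / 2) *\<^sub>R (- s, - 1) \<in> Omega"
      using Omega_segment[of z s 1 "t / 2"] z s t z2 t\<theta> \<theta> by (simp add: Z_def)
    moreover have "s * fst (z + t *\<^sub>R (1 / 2) *\<^sub>R (- s, - 1)) = s * fst z - t / 2"
      using s2 by (simp add: algebra_simps)
    ultimately show "z + t *\<^sub>R (1 / 2) *\<^sub>R (- s, - 1) \<in> E"
      using z t z2 t\<theta> \<theta> by (simp add: E_def Z_def)
  qed (use \<open>D \<in> poly2_deg_le n\<close> in auto)
  also have "\<dots> \<le> ennreal ((5 * exp 2) powr p) * (ennreal (?K powr p) * mass p Omega P)"
    by (intro mult_left_mono E) auto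
  also have "\<dots> = ennreal ((5 * exp 2 * ?K) powr p) * mass p Omega P"
    unfolding powr_mult[of "5 * exp 2" ?K] ennreal_mult[OF powr_ge_zero powr_ge_zero] by (rule mult.assoc[symmetric])
  finally have Z: "mass p Z D \<le> ennreal ((5 * exp 2 * ?K) powr p) * mass p Omega P" .
  let ?L = "10000 * exp 4 * (real n) ^ 4"
  define w where "w = exp 2 * (real n) ^ 4"
  have "(real n)\<^sup>2 * (real n)\<^sup>2 = (real n) ^ 4" by (simp flip: power_add)
  then have K: "?K = 1320 * w" by (simp add: w_def)
  have "exp 4 = exp 2 * (exp 2 :: real)" by (simp flip: exp_add)
  then have L: "?L = 10000 * (exp 2 * w)" by (simp add: w_def)
  have "1 * w \<le> exp 2 * w" by (intro mult_right_mono) (auto simp: w_def)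
  moreover have "0 \<le> w" by (simp add: w_def)
  moreover have "5 * exp 2 * (1320 * w) = 6600 * (exp 2 * w)" by simp
  ultimately have "?K \<le> ?L" "5 * exp 2 * ?K \<le> ?L"
    unfolding K L by linarith+
  then have KL: "ennreal (?K powr p) * mass p Omega P \<le> ennreal (?L powr p) * mass p Omega P"
    "ennreal ((5 * exp 2 * ?K) powr p) * mass p Omega P \<le> ennreal (?L powr p) * mass p Omega P"
    using p by (auto intro!: mult_right_mono ennreal_leI powr_mono2)
  have "{z \<in> Omega. 1 / 2 \<le> s * fst z} = E \<union> Z"
    using \<theta> by (auto simp: E_def Z_def)
  then have "mass p {z \<in> Omega. 1 / 2 \<le> s * fst z} D \<le> mass p E D + mass p Z D"
    using mass_Un_le[of E Z D p] by simp
  also have "\<dots> \<le> ennreal (?L powr p) * mass p Omega P + ennreal (?L powr p) * mass p Omega P"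
    using order_trans[OF E KL(1)] order_trans[OF Z KL(2)] by (rule add_mono)
  finally show ?thesis by (simp add: mult_2)
qed

text \<open>Far from the cusps two transversal steps of fixed length are available, upward from the
  low part \<open>E\<close> and downward from the high part \<open>Z\<close>. This gives order n^2,
  weakened to n^4.\<close>

lemma mass_Omega_middle_le:
  assumes p: "p \<ge> 1" and n: "n \<ge> 1" and P: "P \<in> poly2_deg_le n"
    and e: "\<bar>fst e\<bar> \<le> 1" "\<bar>snd e\<bar> \<le> 1"
  defines "D \<equiv> \<lambda>z. fst e * partial_x P z + snd e * partial_y P z"
  shows "mass p {z \<in> Omega. \<bar>fst z\<bar> \<le> 1 / 2} D
    \<le> 2 * (ennreal ((10000 * exp 4 * (real n) ^ 4) powr p) * mass p Omega P)"
proof -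
  define E where "E = {z \<in> Omega. \<bar>fst z\<bar> \<le> 1 / 2 \<and> snd z < - 1 / 4}"
  define Z where "Z = {z \<in> Omega. \<bar>fst z\<bar> \<le> 1 / 2 \<and> - 1 / 4 \<le> snd z}"
  have [measurable]: "E \<in> sets borel" "Z \<in> sets borel"
    unfolding E_def Z_def by (auto intro!: sets_Collect_mem)
  have "D \<in> poly2_deg_le n"
    unfolding D_def by (intro poly2_deg_le_add poly2_deg_le_cmult poly2_partials[OF P])
  then have [measurable]: "D \<in> borel_measurable borel" by (rule poly2_measurable)
  \<comment> \<open>The coefficients add up to at most 16 + 32 + 16 = 64 on \<open>E\<close> and to
    at most 48 on \<open>Z\<close>.\<close>
  let ?K = "64 * (20 * exp 2 * (real n)\<^sup>2)"
  have E: "mass p E D \<le> ennreal (?K powr p) * mass p Omega P"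
    unfolding D_def
  proof (rule mass_partial_le[OF p n P, where u = "(0, 1 / 16)" and v = "(1 / 16, 1 / 8)"
        and \<alpha> = "16 * snd e - 32 * fst e" and \<beta> = "16 * fst e"])
    fix z :: "real \<times> real" and t :: real assume z: "z \<in> E" and t: "0 \<le> t" "t \<le> 1"
    have sq: "(fst z)\<^sup>2 \<ge> 0" "(fst z + t / 16)\<^sup>2 \<ge> 0" by auto
    have "\<bar>fst z + t / 16\<bar> \<le> \<bar>fst z\<bar> + t / 16" using t by linarith
    moreover have "4 * snd z + t / 2 < 0" using z t by (auto simp: E_def)
    then have "4 * snd z + t / 4 < (fst z)\<^sup>2" "4 * snd z + t / 2 < (fst z + t / 16)\<^sup>2"
      using sq t by linarith+
    ultimately show "z + t *\<^sub>R (0, 1 / 16) \<in> Omega" "z + t *\<^sub>R (1 / 16, 1 / 8) \<in> Omega"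
      using z t by (auto simp: E_def mem_Omega_iff)
  qed (use e in \<open>auto simp: prod_eq_iff field_simps\<close>)
  have Z: "mass p Z D \<le> ennreal (?K powr p) * mass p Omega P"
    unfolding D_def
  proof (rule mass_partial_le[OF p n P, where u = "(0, - 1 / 16)" and v = "(1 / 16, - 1 / 16)"
        and \<alpha> = "- 16 * snd e - 16 * fst e" and \<beta> = "16 * fst e"])
    fix z :: "real \<times> real" and t :: real assume z: "z \<in> Z" and t: "0 \<le> t" "t \<le> 1"
    have "- (1 / 2) * t \<le> fst z * t" using z t by (intro mult_right_mono) (auto simp: Z_def)
    moreover have "(fst z + t / 16)\<^sup>2 = (fst z)\<^sup>2 + fst z * t / 8 + (t / 16)\<^sup>2"
      by (simp add: power2_eq_square field_simps)
    moreover have "4 * snd z < (fst z)\<^sup>2" using z by (simp add: Z_def mem_Omega_iff)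
    ultimately have "4 * snd z - t / 4 < (fst z + t / 16)\<^sup>2"
      using t zero_le_power2[of "t / 16"] by linarith
    moreover have "\<bar>fst z + t / 16\<bar> \<le> \<bar>fst z\<bar> + t / 16" using t by linarith
    ultimately show "z + t *\<^sub>R (0, - 1 / 16) \<in> Omega" "z + t *\<^sub>R (1 / 16, - 1 / 16) \<in> Omega"
      using z t by (auto simp: Z_def mem_Omega_iff)
  qed (use e in \<open>auto simp: prod_eq_iff field_simps\<close>)
  have "?K \<le> 10000 * exp 4 * (real n) ^ 4"
  proof -
    have "(real n)\<^sup>2 \<le> (real n) ^ 4" using n by (intro power_increasing) auto
    then have "exp 2 * (real n)\<^sup>2 \<le> exp 4 * (real n) ^ 4" by (intro mult_mono) auto
    moreover have "0 \<le> exp 4 * (real n) ^ 4" by simp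
    ultimately show ?thesis by linarith
  qed
  then have KL: "ennreal (?K powr p) * mass p Omega P
      \<le> ennreal ((10000 * exp 4 * (real n) ^ 4) powr p) * mass p Omega P"
    using p by (auto intro!: mult_right_mono ennreal_leI powr_mono2)
  have "{z \<in> Omega. \<bar>fst z\<bar> \<le> 1 / 2} = E \<union> Z"
    by (auto simp: E_def Z_def)
  then have "mass p {z \<in> Omega. \<bar>fst z\<bar> \<le> 1 / 2} D \<le> mass p E D + mass p Z D"
    using mass_Un_le[of E Z D p] by simp
  also have "\<dots> \<le> 2 * (ennreal ((10000 * exp 4 * (real n) ^ 4) powr p) * mass p Omega P)"
    unfolding mult_2 using order_trans[OF E KL] order_trans[OF Z KL] by (rule add_mono)
  finally show ?thesis .
qed

text \<open>Two cusp neighbourhoods and the middle cover the domain, each costing 2X; the factor 6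
  enters the p-th power through 6 \<le> 6^p.\<close>

lemma mass_Omega_partial_le:
  assumes p: "p \<ge> 1" and n: "n \<ge> 1" and P: "P \<in> poly2_deg_le n"
    and e: "\<bar>fst e\<bar> \<le> 1" "\<bar>snd e\<bar> \<le> 1"
  shows "mass p Omega (\<lambda>z. fst e * partial_x P z + snd e * partial_y P z)
    \<le> ennreal ((60000 * exp 4 * (real n) ^ 4) powr p) * mass p Omega P"
proof -
  define D where "D = (\<lambda>z. fst e * partial_x P z + snd e * partial_y P z)"
  define X where "X = ennreal ((10000 * exp 4 * (real n) ^ 4) powr p) * mass p Omega P"
  have "D \<in> poly2_deg_le n"
    unfolding D_def by (intro poly2_deg_le_add poly2_deg_le_cmult poly2_partials[OF P])
  then have [measurable]: "D \<in> borel_measurable borel" by (rule poly2_measurable)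
  define A where "A s = {z \<in> Omega. 1 / 2 \<le> s * fst z}" for s
  define B where "B = {z \<in> Omega. \<bar>fst z\<bar> \<le> 1 / 2}"
  have [measurable]: "A s \<in> sets borel" "B \<in> sets borel" for s
    unfolding A_def B_def by (auto intro!: sets_Collect_mem)
  have "Omega = A 1 \<union> (A (- 1) \<union> B)" by (auto simp: A_def B_def)
  then have "mass p Omega D \<le> mass p (A 1) D + mass p (A (- 1) \<union> B) D"
    using mass_Un_le[of "A 1" "A (- 1) \<union> B" D p] by simp
  also have "\<dots> \<le> mass p (A 1) D + (mass p (A (- 1)) D + mass p B D)"
    by (intro add_left_mono mass_Un_le) auto
  also have "\<dots> \<le> 2 * X + (2 * X + 2 * X)"
    unfolding A_def B_def D_def X_def
    by (intro add_mono mass_Omega_near_cusp_le mass_Omega_middle_le p n P e) auto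
  also have "\<dots> = 6 * X"
    by (simp flip: distrib_right)
  also have "\<dots> \<le> ennreal (6 powr p) * X"
  proof (rule mult_right_mono)
    have "6 powr 1 \<le> (6 :: real) powr p" using p by (intro powr_mono) auto
    then have "ennreal 6 \<le> ennreal (6 powr p)" by (intro ennreal_leI) simp
    then show "6 \<le> ennreal (6 powr p)" by simp
  qed simp
  also have "\<dots> = ennreal ((60000 * exp 4 * (real n) ^ 4) powr p) * mass p Omega P"
  proof -
    have "60000 * exp 4 * (real n) ^ 4 = 6 * (10000 * exp 4 * (real n) ^ 4)" by simp
    then have "(60000 * exp 4 * (real n) ^ 4) powr p = 6 powr p * (10000 * exp 4 * (real n) ^ 4) powr p"
      by (simp only: powr_mult)
    then show ?thesis unfolding X_def by (simp add: ennreal_mult mult.assoc)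
  qed
  finally show ?thesis unfolding D_def .
qed

lemma markov_inequality_Omega_4:
  assumes p: "p \<ge> 1"
  shows "markov_inequality p Omega 4"
  unfolding markov_inequality_def
proof (intro exI[of _ "60000 * exp 4"] conjI allI impI ballI)
  fix n :: nat and P assume n: "n \<ge> 1" and P: "P \<in> poly2_deg_le n"
  let ?L = "60000 * exp 4 * (real n) ^ 4"
  note meas = poly2_measurable[OF poly2_partials(1)[OF P]] poly2_measurable[OF poly2_partials(2)[OF P]]
    poly2_measurable[OF P]
  have fin: "mass p Omega P < \<infinity>"
    using mass_poly2_finite[OF P bounded_Omega Omega_measurable] p by simp
  have main: "Lp_norm p Omega D \<le> ?L * Lp_norm p Omega P"
    if "mass p Omega D \<le> ennreal (?L powr p) * mass p Omega P" "D \<in> borel_measurable borel" for D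
  proof -
    \<comment> \<open>Monotonicity of \<open>enn2real\<close> requires the right-hand side to be
      finite.\<close>
    have "enn2real (mass p Omega D) \<le> enn2real (ennreal (?L powr p) * mass p Omega P)"
      using that(1) fin by (intro enn2real_mono) (auto simp: ennreal_mult_less_top)
    also have "\<dots> = ?L powr p * enn2real (mass p Omega P)"
      by (simp add: enn2real_mult)
    finally have "enn2real (mass p Omega D) powr (1 / p) \<le> (?L powr p * enn2real (mass p Omega P)) powr (1 / p)"
      using p by (intro powr_mono2) auto
    also have "\<dots> = ?L * enn2real (mass p Omega P) powr (1 / p)"
      using p by (simp add: powr_mult powr_powr)
    finally show ?thesis
      using that(2) meas by (simp add: Lp_norm_eq_mass)
  qed
  have "Lp_norm p Omega (partial_x P) \<le> ?L * Lp_norm p Omega P"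
    using main[of "partial_x P"] mass_Omega_partial_le[OF p n P, of "(1, 0)"] meas by simp
  moreover have "Lp_norm p Omega (partial_y P) \<le> ?L * Lp_norm p Omega P"
    using main[of "partial_y P"] mass_Omega_partial_le[OF p n P, of "(0, 1)"] meas by simp
  ultimately show "max (Lp_norm p Omega (partial_x P)) (Lp_norm p Omega (partial_y P))
      \<le> 60000 * exp 4 * real n powr 4 * Lp_norm p Omega P"
    using n powr_realpow[of "real n" 4] by simp
qed auto

subsection \<open>Optimality of the exponent\<close>

text \<open>These are the Chebyshev polynomials, built by their three-term recurrence.\<close>

lemma cos_multiple_poly:
  obtains q :: "real poly" where "degree q \<le> k" "\<And>\<phi>. cos (real k * \<phi>) = poly q (cos \<phi>)"
proof -
  have "\<exists>q :: real poly. degree q \<le> k \<and> (\<forall>\<phi>. cos (real k * \<phi>) = poly q (cos \<phi>))"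
  proof (induction k rule: induct_nat_012)
    case 0
    show ?case by (intro exI[of _ 1]) auto
  next
    case 1
    show ?case by (intro exI[of _ "[:0, 1:]"]) auto
  next
    case (ge2 k)
    obtain q1 q2 :: "real poly" where q: "degree q1 \<le> k" "\<forall>\<phi>. cos (real k * \<phi>) = poly q1 (cos \<phi>)"
      "degree q2 \<le> Suc k" "\<forall>\<phi>. cos (real (Suc k) * \<phi>) = poly q2 (cos \<phi>)"
      using ge2 by blast
    have "degree ([:0, 2:] * q2 - q1) \<le> Suc (Suc k)"
    proof (rule degree_diff_le)
      show "degree ([:0, 2:] * q2) \<le> Suc (Suc k)"
        using degree_mult_le[of "[:0, 2:]" q2] q(3) by simp
    qed (use q(1) in simp)
    moreover have "cos (real (Suc (Suc k)) * \<phi>) = poly ([:0, 2:] * q2 - q1) (cos \<phi>)" for \<phi>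
    proof -
      have "cos (real (Suc k) * \<phi> + \<phi>) + cos (real (Suc k) * \<phi> - \<phi>) = 2 * cos \<phi> * cos (real (Suc k) * \<phi>)"
        by (simp add: cos_add cos_diff)
      then have "cos (real (Suc (Suc k)) * \<phi>) = 2 * cos \<phi> * cos (real (Suc k) * \<phi>) - cos (real k * \<phi>)"
        by (simp add: algebra_simps)
      then show ?thesis using q by simp
    qed
    ultimately show ?case by blast
  qed
  then show ?thesis using that by blast
qed

lemma abs_sin_multiple_le: "\<bar>sin (real k * x)\<bar> \<le> real k * \<bar>sin x\<bar>"
proof (induction k)
  case (Suc k)
  have "\<bar>sin (real (Suc k) * x)\<bar> = \<bar>sin (real k * x) * cos x + cos (real k * x) * sin x\<bar>"
    using sin_add[of "real k * x" x] by (simp add: distrib_right add.commute)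
  also have "\<dots> \<le> \<bar>sin (real k * x)\<bar> * \<bar>cos x\<bar> + \<bar>cos (real k * x)\<bar> * \<bar>sin x\<bar>"
    by (metis abs_mult abs_triangle_ineq)
  also have "\<dots> \<le> \<bar>sin (real k * x)\<bar> * 1 + 1 * \<bar>sin x\<bar>"
    by (intro add_mono mult_mono) auto
  finally show ?case using Suc by (simp add: algebra_simps)
qed simp

lemma one_minus_cos: "1 - cos x = 2 * (sin (x / 2))\<^sup>2" for x :: real
  using cos_double_sin[of "x / 2"] by simp

text \<open>Half-angle form of \<open>abs_sin_multiple_le\<close>. It keeps all the cosines in the
  Dirichlet kernel large near the peak.\<close>

lemma cos_multiple_ge: "cos (real k * x) \<ge> 1 - (real k)\<^sup>2 * (1 - cos x)"
proof -
  have "\<bar>sin (real k * x / 2)\<bar>\<^sup>2 \<le> (real k * \<bar>sin (x / 2)\<bar>)\<^sup>2"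
    using abs_sin_multiple_le[of k "x / 2"] by (intro power_mono) auto
  then have "1 - cos (real k * x) \<le> (real k)\<^sup>2 * (1 - cos x)"
    unfolding one_minus_cos by (simp add: power_mult_distrib algebra_simps)
  then show ?thesis by simp
qed

lemma Dirichlet_kernel_sin:
  "(1 + 2 * (\<Sum>k=1..m. cos (real k * x))) * sin (x / 2) = sin ((2 * real m + 1) * (x / 2))"
proof (induction m)
  case (Suc m)
  have "sin ((real m + 1) * x + x / 2) - sin ((real m + 1) * x - x / 2) = 2 * cos ((real m + 1) * x) * sin (x / 2)"
    by (simp add: sin_add sin_diff)
  then have "sin ((2 * real (Suc m) + 1) * (x / 2)) - sin ((2 * real m + 1) * (x / 2))
      = 2 * cos (real (Suc m) * x) * sin (x / 2)"
    by (simp add: algebra_simps)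
  then show ?case using Suc by (simp add: algebra_simps)
qed simp

text \<open>The normalized Dirichlet kernel in the variable \<open>x = 2 cos \<phi>\<close>: it is concentrated where
  \<open>2 - x\<close> is of order \<open>1 / m\<^sup>2\<close>.\<close>

lemma peaking_polynomial:
  obtains F :: "real poly" where "degree F \<le> m"
    "\<And>x. \<bar>x\<bar> \<le> 2 \<Longrightarrow> (2 * real m + 1)\<^sup>2 * (2 - x) * (poly F x)\<^sup>2 \<le> 4"
    "\<And>x. \<bar>x\<bar> \<le> 2 \<Longrightarrow> (real m)\<^sup>2 * (2 - x) \<le> 1 \<Longrightarrow> poly F x \<ge> 1 / 2"
proof -
  have "\<exists>T :: nat \<Rightarrow> real poly. \<forall>k. degree (T k) \<le> k \<and> (\<forall>\<phi>. cos (real k * \<phi>) = poly (T k) (cos \<phi>))"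
    by (intro choice allI) (metis cos_multiple_poly)
  then obtain T :: "nat \<Rightarrow> real poly"
    where T: "\<And>k. degree (T k) \<le> k" "\<And>k \<phi>. cos (real k * \<phi>) = poly (T k) (cos \<phi>)"
    by blast
  \<comment> \<open>Dividing by 2m + 1, the value of the kernel at \<phi> = 0, normalizes F(2) to
    1.\<close>
  define F where "F = Polynomial.smult (1 / (2 * real m + 1)) (1 + Polynomial.smult 2 (\<Sum>k=1..m. pcompose (T k) [:0, 1 / 2:]))"
  have degT: "degree (pcompose (T k) [:0, 1 / 2:]) \<le> m" if "k \<in> {1..m}" for k
    using T(1)[of k] that by (simp add: degree_pcompose)
  have "degree (\<Sum>k=1..m. pcompose (T k) [:0, 1 / 2:]) \<le> m"
    using degT by (intro degree_sum_le) auto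
  then have deg: "degree F \<le> m"
    unfolding F_def by (intro order_trans[OF degree_smult_le] degree_add_le) auto
  define D where "D \<phi> = 1 + 2 * (\<Sum>k=1..m. cos (real k * \<phi>))" for \<phi>
  have F: "(2 * real m + 1) * poly F (2 * cos \<phi>) = D \<phi>" for \<phi>
    unfolding F_def D_def using T(2) by (simp add: poly_sum poly_pcompose field_simps)
  have x: "x = 2 * cos (arccos (x / 2))" if "\<bar>x\<bar> \<le> 2" for x :: real
    using that by (subst cos_arccos) auto
  show ?thesis
  proof (rule that[OF deg])
    fix x :: real assume "\<bar>x\<bar> \<le> 2"
    then obtain \<phi> where \<phi>: "x = 2 * cos \<phi>" using x by blast
    have "2 - x = 4 * (sin (\<phi> / 2))\<^sup>2" using one_minus_cos[of \<phi>] \<phi> by simp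
    then have "(2 * real m + 1)\<^sup>2 * (2 - x) * (poly F x)\<^sup>2
       = 4 * (((2 * real m + 1) * poly F (2 * cos \<phi>)) * sin (\<phi> / 2))\<^sup>2"
      by (simp add: \<phi> power_mult_distrib)
    also have "\<dots> = 4 * (sin ((2 * real m + 1) * (\<phi> / 2)))\<^sup>2"
      unfolding F D_def Dirichlet_kernel_sin ..
    also have "\<dots> \<le> 4 * 1"
      by (intro mult_left_mono) (auto simp: abs_square_le_1)
    finally show "(2 * real m + 1)\<^sup>2 * (2 - x) * (poly F x)\<^sup>2 \<le> 4" by simp
  next
    fix x :: real assume "\<bar>x\<bar> \<le> 2" and small: "(real m)\<^sup>2 * (2 - x) \<le> 1"
    then obtain \<phi> where \<phi>: "x = 2 * cos \<phi>" using x by blast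
    have "cos (real k * \<phi>) \<ge> 1 / 2" if k: "k \<in> {1..m}" for k
    proof -
      have "(real k)\<^sup>2 * (1 - cos \<phi>) \<le> (real m)\<^sup>2 * (1 - cos \<phi>)"
        using k by (intro mult_right_mono power_mono) auto
      \<comment> \<open>Since 1 - cos \<phi> = (2 - x)/2, the assumption bounds the loss by
        1/2.\<close>
      then show ?thesis using cos_multiple_ge[of k \<phi>] small \<phi> by (simp add: algebra_simps)
    qed
    then have "(\<Sum>k=1..m. cos (real k * \<phi>)) \<ge> (\<Sum>k=1..m. 1 / 2)" by (intro sum_mono) auto
    then have "(2 * real m + 1) * poly F x \<ge> (2 * real m + 1) * (1 / 2)"
      unfolding \<phi> F D_def by simp
    then show "poly F x \<ge> 1 / 2" by (subst (asm) mult_le_cancel_left_pos) auto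
  qed
qed

section \<open>Test polynomials at the cusp (2, 1)\<close>

lemma poly2_deg_le_poly_fst:
  assumes "degree q + j \<le> n"
  shows "(\<lambda>(x, y). poly q x * y ^ j) \<in> poly2_deg_le n"
proof -
  have "(\<lambda>(x, y). poly q x * y ^ j) = (\<lambda>z. \<Sum>i\<le>degree q. (\<lambda>(x, y). coeff q i * x ^ i * y ^ j) z)"
    by (auto simp: poly_altdef sum_distrib_right)
  also have "\<dots> \<in> poly2_deg_le n"
    using assms by (intro poly2_deg_le_sum poly2_deg_le_monomial) auto
  finally show ?thesis .
qed

lemma poly2_deg_le_cusp_product:
  assumes "degree G < n"
  shows "(\<lambda>(x, y). (y - x + 1) * poly G x) \<in> poly2_deg_le n"
proof -
  have "degree ([:1, - 1:] * G) + 0 \<le> n"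
    using degree_mult_le[of "[:1, - 1 :: real:]" G] assms by simp
  then have "(\<lambda>z. (\<lambda>(x, y). poly ([:1, - 1:] * G) x * y ^ 0) z + (\<lambda>(x, y). poly G x * y ^ 1) z) \<in> poly2_deg_le n"
    using assms by (intro poly2_deg_le_add poly2_deg_le_poly_fst) auto
  also have "(\<lambda>z. (\<lambda>(x, y). poly ([:1, - 1:] * G) x * y ^ 0) z + (\<lambda>(x, y). poly G x * y ^ 1) z)
    = (\<lambda>(x, y). (y - x + 1) * poly G x)"
    by (auto simp: algebra_simps)
  finally show ?thesis .
qed

lemma partial_y_cusp_product:
  "partial_y (\<lambda>(x, y). (y - x + 1) * poly G x) = (\<lambda>(x, y). poly G x)"
proof (intro ext)
  fix z :: "real \<times> real"
  have "((\<lambda>t. (t - fst z + 1) * poly G (fst z)) has_real_derivative poly G (fst z)) (at (snd z))"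
    by (auto intro!: derivative_eq_intros)
  then show "partial_y (\<lambda>(x, y). (y - x + 1) * poly G x) z = (\<lambda>(x, y). poly G x) z"
    by (simp add: partial_y_def case_prod_unfold DERIV_imp_deriv)
qed

text \<open>Within horizontal distance \<rho> of the cusp the linear factor is at most \<rho>^2/4;
  farther away it is at most 4, and \<open>G\<close> is at most \<open>t\<close>.\<close>

lemma mass_cusp_product_le:
  assumes p: "p \<ge> 1" and \<rho>: "\<rho> > 0" and t: "t \<ge> 0"
    and G: "\<And>x. \<bar>x\<bar> \<le> 2 \<Longrightarrow> 2 - x > \<rho> \<Longrightarrow> \<bar>poly G x\<bar> \<le> t"
  shows "mass p Omega (\<lambda>(x, y). (y - x + 1) * poly G x)
    \<le> ennreal ((\<rho>\<^sup>2 / 4) powr p) * mass p Omega (\<lambda>(x, y). poly G x) + ennreal (measure lborel Omega * (4 * t) powr p)"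
proof -
  have bound: "\<bar>(y - x + 1) * poly G x\<bar> powr p \<le> (\<rho>\<^sup>2 / 4) powr p * \<bar>poly G x\<bar> powr p + (4 * t) powr p"
    if "(x, y) \<in> Omega" for x y
  proof -
    have xy: "\<bar>x\<bar> < 2" "\<bar>x\<bar> < y + 1" "x\<^sup>2 > 4 * y" using that by (auto simp: Omega_def)
    then have "x < y + 1" using abs_ge_self[of x] by linarith
    have "(2 - x)\<^sup>2 = x\<^sup>2 - 4 * x + 4" by (simp add: power2_eq_square algebra_simps)
    \<comment> \<open>From 4y < x^2 follows y - x + 1 < x^2/4 - x + 1 = (2 - x)^2/4.\<close>
    then have \<eta>: "0 \<le> y - x + 1" "y - x + 1 \<le> (2 - x)\<^sup>2 / 4" using xy \<open>x < y + 1\<close> by auto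
    show ?thesis
    proof (cases "2 - x \<le> \<rho>")
      case True
      then have "(2 - x)\<^sup>2 \<le> \<rho>\<^sup>2" using xy by (intro power_mono) auto
      then have "\<bar>(y - x + 1) * poly G x\<bar> \<le> \<rho>\<^sup>2 / 4 * \<bar>poly G x\<bar>"
        unfolding abs_mult using \<eta> by (intro mult_right_mono) auto
      then have "\<bar>(y - x + 1) * poly G x\<bar> powr p \<le> (\<rho>\<^sup>2 / 4 * \<bar>poly G x\<bar>) powr p"
        using p by (intro powr_mono2) auto
      also have "\<dots> = (\<rho>\<^sup>2 / 4) powr p * \<bar>poly G x\<bar> powr p" by (rule powr_mult)
      finally show ?thesis by (rule order_trans) simp
    next
      case False
      have "(2 - x)\<^sup>2 \<le> 4\<^sup>2" using xy by (intro power_mono) auto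
      then have "\<bar>y - x + 1\<bar> \<le> 4" using \<eta> by simp
      then have "\<bar>(y - x + 1) * poly G x\<bar> \<le> 4 * t"
        unfolding abs_mult using G[of x] xy False by (intro mult_mono) auto
      then have "\<bar>(y - x + 1) * poly G x\<bar> powr p \<le> (4 * t) powr p"
        using p by (intro powr_mono2) auto
      then show ?thesis by (rule order_trans) simp
    qed
  qed
  define g :: "real \<times> real \<Rightarrow> real" where "g = (\<lambda>(x, y). poly G x)"
  have [measurable]: "g \<in> borel_measurable borel"
    unfolding g_def using poly2_measurable[OF poly2_deg_le_poly_fst[of G 0 "degree G"]] by simp
  have "mass p Omega (\<lambda>(x, y). (y - x + 1) * poly G x)
    \<le> (\<integral>\<^sup>+z. ennreal ((\<rho>\<^sup>2 / 4) powr p) * (ennreal (\<bar>(\<lambda>(x, y). poly G x) z\<bar> powr p) * indicator Omega z)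
        + ennreal ((4 * t) powr p) * indicator Omega z \<partial>lborel)"
    unfolding mass_def
  proof (rule nn_integral_mono)
    fix z :: "real \<times> real"
    show "ennreal (\<bar>(\<lambda>(x, y). (y - x + 1) * poly G x) z\<bar> powr p) * indicator Omega z
      \<le> ennreal ((\<rho>\<^sup>2 / 4) powr p) * (ennreal (\<bar>(\<lambda>(x, y). poly G x) z\<bar> powr p) * indicator Omega z)
        + ennreal ((4 * t) powr p) * indicator Omega z"
    proof (cases "z \<in> Omega")
      case True
      obtain x y where z: "z = (x, y)" by (cases z)
      have "ennreal (\<bar>(y - x + 1) * poly G x\<bar> powr p)
        \<le> ennreal ((\<rho>\<^sup>2 / 4) powr p * \<bar>poly G x\<bar> powr p + (4 * t) powr p)"
        using bound True z by (intro ennreal_leI) blast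
      also have "\<dots> = ennreal ((\<rho>\<^sup>2 / 4) powr p) * ennreal (\<bar>poly G x\<bar> powr p) + ennreal ((4 * t) powr p)"
        unfolding ennreal_mult[OF powr_ge_zero powr_ge_zero, symmetric]
        by (intro ennreal_plus mult_nonneg_nonneg powr_ge_zero)
      finally show ?thesis using True z by simp
    qed simp
  qed
  also have "\<dots> = ennreal ((\<rho>\<^sup>2 / 4) powr p) * mass p Omega (\<lambda>(x, y). poly G x)
      + ennreal ((4 * t) powr p) * emeasure lborel Omega"
    unfolding mass_def g_def[symmetric]
    by (subst nn_integral_add) (auto simp: nn_integral_cmult)
  also have "emeasure lborel Omega = ennreal (measure lborel Omega)"
    using emeasure_bounded_finite[OF bounded_Omega] by (intro emeasure_eq_ennreal_measure) auto
  also have "ennreal ((4 * t) powr p) * \<dots> = ennreal (measure lborel Omega * (4 * t) powr p)"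
    by (subst ennreal_mult[symmetric]) (auto simp: mult.commute)
  finally show ?thesis .
qed

text \<open>A box inside the cusp region, on which \<open>G\<close> is at least \<open>c\<close>,
  already has area 1/(4096 m^8).\<close>

lemma mass_peak_ge:
  assumes p: "p \<ge> 1" and m: "m \<ge> 1" and c: "c \<ge> 0"
    and G: "\<And>x. \<bar>x\<bar> \<le> 2 \<Longrightarrow> (real m)\<^sup>2 * (2 - x) \<le> 1 \<Longrightarrow> \<bar>poly G x\<bar> \<ge> c"
  shows "ennreal (c powr p * (1 / (4096 * real m ^ 8))) \<le> mass p Omega (\<lambda>(x, y). poly G x)"
proof -
  define a where "a = 1 / (2 * (real m)\<^sup>2)"
  have m2: "(real m)\<^sup>2 \<ge> 1" using m by simp
  then have "1 / (2 * (real m)\<^sup>2) \<le> 1 / (2 * 1)" using m by (intro divide_left_mono) auto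
  then have a: "0 < a" "a \<le> 1 / 2" "(real m)\<^sup>2 * a = 1 / 2" using m unfolding a_def by auto
  have aa: "a\<^sup>2 \<le> a / 2" using a mult_right_mono[of a "1 / 2" a] by (simp add: power2_eq_square)
  have a2: "a\<^sup>2 > 0" using a by simp
  \<comment> \<open>At x = 2 - a the vertical section has height a^2/4 above y = 1 - a. The box is
    centred at the middle of this section with side a^2/16.\<close>
  define l where "l = (2 - a - a\<^sup>2 / 32, 1 - a + a\<^sup>2 / 8 - a\<^sup>2 / 32)"
  define u where "u = (2 - a + a\<^sup>2 / 32, 1 - a + a\<^sup>2 / 8 + a\<^sup>2 / 32)"
  have box: "(x, y) \<in> Omega \<and> \<bar>x\<bar> \<le> 2 \<and> (real m)\<^sup>2 * (2 - x) \<le> 1" if "(x, y) \<in> cbox l u" for x y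
  proof -
    have x: "2 - a - a\<^sup>2 / 32 \<le> x" "x \<le> 2 - a + a\<^sup>2 / 32"
      and y: "1 - a + a\<^sup>2 / 8 - a\<^sup>2 / 32 \<le> y" "y \<le> 1 - a + a\<^sup>2 / 8 + a\<^sup>2 / 32"
      using that by (auto simp: l_def u_def cbox_Pair_eq)
    have x2: "0 < x" "x < 2" using x a aa by linarith+
    have "x < y + 1" using x y a2 by linarith
    have "(63 / 64 * a)\<^sup>2 \<le> (2 - x)\<^sup>2" using x a aa by (intro power_mono) linarith+
    moreover have "(2 - x)\<^sup>2 = x\<^sup>2 - 4 * x + 4" by (simp add: power2_eq_square algebra_simps)
    ultimately have "4 * y < x\<^sup>2" using x y a2 by (simp add: power_mult_distrib power2_eq_square)
    moreover have "(real m)\<^sup>2 * (2 - x) \<le> (real m)\<^sup>2 * (2 * a)"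
      using x a aa by (intro mult_left_mono) (linarith, simp)
    ultimately show ?thesis using x2 \<open>x < y + 1\<close> a by (auto simp: Omega_def)
  qed
  have "emeasure lborel (cbox l u) = ennreal (1 / (4096 * real m ^ 8))"
  proof -
    have "emeasure lborel (cbox l u) = ennreal ((a\<^sup>2 / 16) * (a\<^sup>2 / 16))"
      unfolding l_def u_def using a2
      by (subst emeasure_lborel_cbox) (auto simp: Basis_prod_def inner_prod_def prod.union_disjoint)
    also have "(a\<^sup>2 / 16) * (a\<^sup>2 / 16) = 1 / (4096 * real m ^ 8)"
      unfolding a_def by (simp add: power_mult_distrib power_divide flip: power_mult power_add)
    finally show ?thesis .
  qed
  then have "ennreal (c powr p * (1 / (4096 * real m ^ 8))) = (\<integral>\<^sup>+z. ennreal (c powr p) * indicator (cbox l u) z \<partial>lborel)"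
    by (subst nn_integral_cmult_indicator) (auto simp: ennreal_mult[symmetric])
  also have "\<dots> \<le> mass p Omega (\<lambda>(x, y). poly G x)"
    unfolding mass_def
  proof (rule nn_integral_mono)
    fix z :: "real \<times> real"
    show "ennreal (c powr p) * indicator (cbox l u) z
      \<le> ennreal (\<bar>(\<lambda>(x, y). poly G x) z\<bar> powr p) * indicator Omega z"
      using box[of "fst z" "snd z"] G[of "fst z"] p c
      by (cases z) (auto split: split_indicator intro!: ennreal_leI powr_mono2)
  qed
  finally show ?thesis .
qed

text \<open>With G = F^(4I), the near-cusp part of the norm of \<open>P\<close> is absorbed into the
  norm of its y-derivative, so the far part must dominate the mass of the peak. The factor (L/m^4)^I
  makes the far part small when \<open>L\<close> grows more slowly than m^4.\<close>

lemma markov_constant_lower_bound: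
  assumes p: "p \<ge> 1" and m: "m \<ge> 1" and L: "L > 0"
    and markov: "\<And>P. P \<in> poly2_deg_le (4 * I * m + 1) \<Longrightarrow> Lp_norm p Omega (partial_y P) \<le> L * Lp_norm p Omega P"
  shows "(1 / 2) ^ (4 * I) * (1 / (4096 * real m ^ 8))
    \<le> (2 * measure lborel Omega + 1) * 4 * (L / (2 * real m ^ 4)) ^ I * L"
proof -
  obtain F where degF: "degree F \<le> m"
    and decay: "\<And>x. \<bar>x\<bar> \<le> 2 \<Longrightarrow> (2 * real m + 1)\<^sup>2 * (2 - x) * (poly F x)\<^sup>2 \<le> 4"
    and peak: "\<And>x. \<bar>x\<bar> \<le> 2 \<Longrightarrow> (real m)\<^sup>2 * (2 - x) \<le> 1 \<Longrightarrow> poly F x \<ge> 1 / 2"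
    by (rule peaking_polynomial[of m]) blast
  define G where "G = F ^ (4 * I)"
  define P where "P = (\<lambda>(x, y). (y - x + 1) * poly G x)"
  define g where "g = (\<lambda>(x, y :: real). poly G x)"
  \<comment> \<open>Chosen so that L * \<rho>^2/4 = 1/2, which permits the absorption.\<close>
  define \<rho> where "\<rho> = sqrt (2 / L)"
  \<comment> \<open>The decay of \<open>F\<close> gives F^2 \<le> 1/(m^2 \<rho>) beyond \<rho>; this
    is its power 2I.\<close>
  define t where "t = (L / (2 * real m ^ 4)) ^ I"
  define V where "V = measure lborel Omega"
  define A where "A = enn2real (mass p Omega g)"
  define B where "B = enn2real (mass p Omega P)"
  have \<rho>: "\<rho> > 0" "\<rho>\<^sup>2 = 2 / L" using L by (auto simp: \<rho>_def)
  have t: "t \<ge> 0" using L by (simp add: t_def)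
  have V: "V \<ge> 0" by (simp add: V_def)
  have "degree G \<le> 4 * I * m"
    unfolding G_def using degF by (intro order_trans[OF degree_power_le]) (simp add: mult.commute)
  then have P: "P \<in> poly2_deg_le (4 * I * m + 1)" and g: "g \<in> poly2_deg_le (4 * I * m + 1)"
    using poly2_deg_le_cusp_product[of G] poly2_deg_le_poly_fst[of G 0] by (auto simp: P_def g_def)
  have Py: "partial_y P = g" unfolding P_def g_def by (rule partial_y_cusp_product)
  have fin: "mass p Omega g = ennreal A" "mass p Omega P = ennreal B"
    using mass_poly2_finite[OF g bounded_Omega Omega_measurable, of p]
      mass_poly2_finite[OF P bounded_Omega Omega_measurable, of p] p by (auto simp: A_def B_def)
  have AB: "A \<ge> 0" "B \<ge> 0" by (auto simp: A_def B_def)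

  have "A powr (1 / p) \<le> L * B powr (1 / p)"
    using markov[OF P] unfolding Py
    by (simp add: Lp_norm_eq_mass poly2_measurable[OF P] poly2_measurable[OF g] A_def B_def)
  then have "(A powr (1 / p)) powr p \<le> (L * B powr (1 / p)) powr p"
    using p by (intro powr_mono2) auto
  then have 1: "A \<le> L powr p * B" using p AB by (simp add: powr_mult powr_powr)

  have "\<bar>poly G x\<bar> \<le> t" if x: "\<bar>x\<bar> \<le> 2" "2 - x > \<rho>" for x
  proof -
    have "(2 * real m)\<^sup>2 * \<rho> * (poly F x)\<^sup>2 \<le> (2 * real m + 1)\<^sup>2 * (2 - x) * (poly F x)\<^sup>2"
      using x \<rho> by (intro mult_right_mono mult_mono power_mono) auto
    also have "\<dots> \<le> 4" by (rule decay[OF x(1)])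
    finally have "(real m)\<^sup>2 * \<rho> * (poly F x)\<^sup>2 \<le> 1" by (simp add: power_mult_distrib)
    then have "(poly F x)\<^sup>2 \<le> 1 / ((real m)\<^sup>2 * \<rho>)"
      using m \<rho> by (simp add: field_simps)
    then have "((poly F x)\<^sup>2) ^ (2 * I) \<le> (1 / ((real m)\<^sup>2 * \<rho>)) ^ (2 * I)"
      by (intro power_mono) auto
    also have "\<dots> = (1 / (real m ^ 4 * \<rho>\<^sup>2)) ^ I"
      by (simp add: power_mult power_mult_distrib power_one_over flip: power_mult)
    also have "\<dots> = t" using L by (simp add: \<rho>(2) t_def mult.commute)
    finally show ?thesis by (simp add: G_def poly_power power_abs power_even_abs flip: power_mult)
  qed
  then have "mass p Omega P \<le> ennreal ((\<rho>\<^sup>2 / 4) powr p) * mass p Omega g + ennreal (V * (4 * t) powr p)"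
    unfolding P_def g_def V_def by (intro mass_cusp_product_le[OF p \<rho>(1) t]) auto
  also have "\<dots> = ennreal ((\<rho>\<^sup>2 / 4) powr p * A + V * (4 * t) powr p)"
    unfolding fin using AB V by (subst ennreal_plus) (auto simp: ennreal_mult)
  finally have 2: "B \<le> (\<rho>\<^sup>2 / 4) powr p * A + V * (4 * t) powr p"
    unfolding fin using AB V by (subst (asm) ennreal_le_iff) auto

  have "ennreal (((1 / 2) ^ (4 * I)) powr p * (1 / (4096 * real m ^ 8))) \<le> mass p Omega g"
    unfolding g_def
  proof (rule mass_peak_ge[OF p m])
    fix x :: real assume "\<bar>x\<bar> \<le> 2" "(real m)\<^sup>2 * (2 - x) \<le> 1"
    then have "(1 / 2) ^ (4 * I) \<le> poly F x ^ (4 * I)" by (intro power_mono peak) auto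
    then show "(1 / 2) ^ (4 * I) \<le> \<bar>poly G x\<bar>" by (simp add: G_def poly_power)
  qed simp
  then have 3: "((1 / 2) ^ (4 * I)) powr p * (1 / (4096 * real m ^ 8)) \<le> A"
    unfolding fin using AB by (subst (asm) ennreal_le_iff) auto

  have "(L * (\<rho>\<^sup>2 / 4)) powr p = (1 / 2) powr p" using L by (simp add: \<rho>(2))
  then have half: "L powr p * (\<rho>\<^sup>2 / 4) powr p \<le> 1 / 2"
    using p powr_mono'[of 1 p "1 / 2"] by (simp only: powr_mult) simp
  have "L powr p * B \<le> L powr p * ((\<rho>\<^sup>2 / 4) powr p * A + V * (4 * t) powr p)"
    by (intro mult_left_mono 2) auto
  also have "\<dots> = (L powr p * (\<rho>\<^sup>2 / 4) powr p) * A + V * (4 * t * L) powr p"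
    by (simp add: powr_mult distrib_left mult_ac)
  also have "\<dots> \<le> 1 / 2 * A + V * (4 * t * L) powr p"
    by (intro add_right_mono mult_right_mono half AB)
  finally have "A \<le> 1 / 2 * A + V * (4 * t * L) powr p" using 1 by linarith
  then have 4: "A \<le> 2 * V * (4 * t * L) powr p" by simp

  \<comment> \<open>Since \<mu>^p \<le> \<mu> and 2V \<le> (2V + 1)^p, both sides can be made p-th
    powers, which removes p from the conclusion.\<close>
  define \<mu> where "\<mu> = 1 / (4096 * real m ^ 8)"
  have "real m ^ 8 \<ge> 1" using m by simp
  then have \<mu>: "0 < \<mu>" "\<mu> \<le> 1" using m unfolding \<mu>_def by (simp, intro divide_le_eq_1_pos[THEN iffD2]) linarith+
  have "((1 / 2) ^ (4 * I) * \<mu>) powr p = ((1 / 2) ^ (4 * I)) powr p * \<mu> powr p"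
    by (rule powr_mult)
  also have "\<dots> \<le> ((1 / 2) ^ (4 * I)) powr p * \<mu>"
    using powr_mono'[OF p, of \<mu>] \<mu> by (intro mult_left_mono) auto
  also have "\<dots> \<le> 2 * V * (4 * t * L) powr p" using 3 4 unfolding \<mu>_def by linarith
  also have "\<dots> \<le> (2 * V + 1) powr p * (4 * t * L) powr p"
  proof (intro mult_right_mono)
    show "2 * V \<le> (2 * V + 1) powr p" using powr_mono[OF p, of "2 * V + 1"] V by simp
  qed simp
  also have "\<dots> = ((2 * V + 1) * (4 * t * L)) powr p" by (simp only: powr_mult)
  finally have "(1 / 2) ^ (4 * I) * \<mu> \<le> (2 * V + 1) * (4 * t * L)"
    by (rule contrapos_pp) (use p V t L in \<open>auto simp: not_le intro!: powr_less_mono2\<close>)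
  then show ?thesis unfolding \<mu>_def V_def t_def by (simp only: mult.assoc)
qed

text \<open>With \<open>I\<close> fixed and \<open>L\<close> of order m^r,
  \<open>markov_constant_lower_bound\<close> compares m^(-8) with m^((r - 4)I + r), which fails for
  large m once \<open>I\<close> is large.\<close>

lemma not_markov_inequality_Omega:
  assumes p: "p \<ge> 1" and s: "s < 4"
  shows "\<not> markov_inequality p Omega s"
proof
  assume "markov_inequality p Omega s"
  then obtain M where M: "M > 0" and markov: "\<And>n P. n \<ge> 1 \<Longrightarrow> P \<in> poly2_deg_le n \<Longrightarrow>
      Lp_norm p Omega (partial_y P) \<le> M * real n powr s * Lp_norm p Omega P"
    unfolding markov_inequality_def by auto
  \<comment> \<open>A nonnegative exponent makes the power monotone in the degree.\<close>
  define r where "r = max s 0"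
  have r: "0 \<le> r" "r < 4" "s \<le> r" using s by (auto simp: r_def)
  \<comment> \<open>This makes (r - 4)I + r at most -9, one below the order -8 of the peak
    mass.\<close>
  obtain I :: nat where I: "real I > (9 + r) / (4 - r)" using reals_Archimedean2 by blast
  then have I1: "I \<ge> 1" using r by (cases I) (auto simp: field_simps)
  have I2: "(4 - r) * real I \<ge> 9 + r" using I r by (simp add: field_simps)
  \<comment> \<open>The degree 4Im + 1 is at most 5Im; the part (5I)^r independent of m goes into
    the constant.\<close>
  define N where "N = M * (5 * real I) powr r"
  define V where "V = 2 * measure lborel Omega + 1"
  have N: "N > 0" using M I1 by (simp add: N_def)
  have V: "V > 0" unfolding V_def by (rule add_nonneg_pos) auto
  define K where "K = V * 4 * (N / 2) ^ I * N"
  define c where "c = (1 / 2) ^ (4 * I) / (4096 :: real)"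
  have bound: "c * real m \<le> K" if m: "m \<ge> 1" for m
  proof -
    define L where "L = N * real m powr r"
    have L: "L > 0" using N m by (simp add: L_def)
    let ?n = "4 * I * m + 1"
    have "Lp_norm p Omega (partial_y P) \<le> L * Lp_norm p Omega P" if P: "P \<in> poly2_deg_le ?n" for P
    proof -
      have "I * m \<ge> 1" using I1 m by simp
      then have "?n \<le> 5 * I * m" by simp
      then have n5: "real ?n \<le> 5 * real I * real m" by (metis of_nat_le_iff of_nat_mult of_nat_numeral)
      have "real ?n powr s \<le> real ?n powr r" using r by (intro powr_mono) auto
      also have "\<dots> \<le> (5 * real I * real m) powr r" using n5 r by (intro powr_mono2) auto
      also have "\<dots> = (5 * real I) powr r * real m powr r" by (rule powr_mult)
      finally have "M * real ?n powr s \<le> L"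
        unfolding L_def N_def using M by (simp add: mult.assoc)
      moreover have "Lp_norm p Omega P \<ge> 0" by (simp add: Lp_norm_def)
      ultimately have "M * real ?n powr s * Lp_norm p Omega P \<le> L * Lp_norm p Omega P"
        by (intro mult_right_mono)
      then show ?thesis using markov[OF _ P] by simp
    qed
    then have "(1 / 2) ^ (4 * I) * (1 / (4096 * real m ^ 8)) \<le> V * 4 * (L / (2 * real m ^ 4)) ^ I * L"
      unfolding V_def by (rule markov_constant_lower_bound[OF p m L])
    moreover have "(1 / 2) ^ (4 * I) * (1 / (4096 * real m ^ 8)) = c * real m powr (- 8)"
      using m by (simp add: c_def powr_minus powr_numeral divide_simps)
    moreover have "V * 4 * (L / (2 * real m ^ 4)) ^ I * L = K * real m powr ((r - 4) * real I + r)"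
    proof -
      have "L / (2 * real m ^ 4) = N / 2 * real m powr (r - 4)"
        using m by (simp add: L_def powr_diff powr_numeral)
      then have "(L / (2 * real m ^ 4)) ^ I = (N / 2) ^ I * real m powr ((r - 4) * real I)"
        by (simp only: power_mult_distrib) (use m in \<open>simp add: powr_power mult.commute\<close>)
      then show ?thesis
        by (simp add: K_def L_def powr_add)
    qed
    ultimately have "c * real m powr (- 8) \<le> K * real m powr ((r - 4) * real I + r)" by simp
    also have "\<dots> \<le> K * real m powr (- 9)"
    proof (intro mult_left_mono powr_mono)
      show "(r - 4) * real I + r \<le> - 9" using I2 by (simp add: algebra_simps)
    qed (use m N V in \<open>auto simp: K_def\<close>)
    finally have "c * real m powr (- 8) \<le> K * real m powr (- 9)" .
    then have "(c * real m powr (- 8)) * real m powr 9 \<le> (K * real m powr (- 9)) * real m powr 9"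
      by (rule mult_right_mono) simp
    moreover have "real m powr (- 8) * real m powr 9 = real m" "real m powr (- 9) * real m powr 9 = 1"
      using m powr_add[of "real m" "- 8" 9] powr_add[of "real m" "- 9" 9] by simp_all
    ultimately show ?thesis by (simp only: mult.assoc mult_1_right)
  qed
  obtain m :: nat where m: "real m > max 1 (K / c)" using reals_Archimedean2 by blast
  have "c > 0" by (simp add: c_def)
  then have "K < c * real m" using m by (simp add: field_simps)
  moreover have "m \<ge> 1" using m by simp
  ultimately show False using bound[of m] by simp
qed

theorem mainTheorem1:
  fixes p :: real
  assumes "1 \<le> p"
  shows "is_markov_exponent p Omega 4"
  unfolding is_markov_exponent_def
  using markov_inequality_Omega_4[OF assms] not_markov_inequality_Omega[OF assms] by simp

end
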